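(* Let $\Omega_+\subseteq\Omega\subset\mathbb R^n$ be open bounded sets, $\Omega_-=\Omega\setminus\overline{\Omega_+}$, and assume $\Gamma=\Omega\setminus(\Omega_+\cup\Omega_-)$ satisfies $\Gamma=\partial\Omega_+\cap\Omega=\partial\Omega_-\cap\Omega$. Assume that $\Omega_\pm$ have uniformly Lipschitz regular boundaries. Then there exists a viscosity solution $u\in C(\overline\Omega)$ of $$|Du|-1=0\ \text{in }\Omega_-,\qquad \tfrac12(-\Delta)u-1=0\ \text{in }\Omega_+,\qquad \text{either } |Du|-1=0 \text{ or } \tfrac12(-\Delta)u-1=0\ \text{on }\Gamma,$$ with $u=0$ on $\partial\Omega$.
   Context: Uniformly Lipschitz regular boundary. For a set $D\subset\mathbb R^n$, $\partial D$ is uniformly Lipschitz regular if for every $x_0\in\partial D$ there is a bi-Lipschitz map $\Phi:B_1\to U$ onto a neighborhood $U$ of $x_0=\Phi(0)$, with Lipschitz norm independent of $x_0$, such that $\Phi(B_1\cap\{x_n<0\})=U\cap(\mathbb R^n\setminus\overline D)$, $\Phi(B_1\cap\{x_n>0\})=U\cap D$, $\Phi(B_1\cap\{x_n=0\})=U\cap\partial D$. Viscosity solutions. $\varphi$ touches $u$ from above (below) at $x_0$ if $u\le\varphi$ ($u\ge\varphi$) on the common domain of definition with equality at $x_0$. Write $H_-\varphi=|D\varphi|-1$ and $H_+\varphi=-\tfrac12\Delta\varphi-1$. A continuous $u$ is a viscosity solution of the problem if: for every $\varphi\in C^2(B_r(x_0))$ touching $u$ from above at $x_0\in\Omega$, one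 has $H_-\varphi(x_0)\le0$ if $x_0\in\Omega_-$, $H_+\varphi(x_0)\le0$ if $x_0\in\Omega_+$, and $\min(H_-\varphi(x_0),H_+\varphi(x_0))\le0$ if $x_0\in\Gamma$; and for every $\varphi\in C^2(B_r(x_0))$ touching $u$ from below at $x_0\in\Omega$, one has $H_-\varphi(x_0)\ge0$ if $x_0\in\Omega_-$, $H_+\varphi(x_0)\ge0$ if $x_0\in\Omega_+$, and $\max(H_-\varphi(x_0),H_+\varphi(x_0))\ge0$ if $x_0\in\Gamma$. *)

theory Defs
  imports "HOL-Analysis.Analysis"
begin

definition partial_deriv :: "'n::finite \<Rightarrow> (real ^ 'n \<Rightarrow> real) \<Rightarrow> real ^ 'n \<Rightarrow> real" where
  "partial_deriv i f x = frechet_derivative f (at x) (axis i 1)"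

definition grad :: "(real ^ 'n::finite \<Rightarrow> real) \<Rightarrow> real ^ 'n \<Rightarrow> real ^ 'n" where
  "grad f x = (\<chi> i. partial_deriv i f x)"

definition laplacian :: "(real ^ 'n::finite \<Rightarrow> real) \<Rightarrow> real ^ 'n \<Rightarrow> real" where
  "laplacian f x = (\<Sum>i\<in>UNIV. partial_deriv i (partial_deriv i f) x)"

text \<open>Meant for open \<open>S\<close>, where \<open>differentiable_on\<close> is differentiability at every point of \<open>S\<close>
  and the derivatives depend only on the values on \<open>S\<close>.\<close>

definition C2_on :: "(real ^ 'n::finite) set \<Rightarrow> (real ^ 'n \<Rightarrow> real) \<Rightarrow> bool" where
  "C2_on S f \<longleftrightarrow> f differentiable_on S \<and>
     (\<forall>i. partial_deriv i f differentiable_on S) \<and>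
     (\<forall>i j. continuous_on S (partial_deriv j (partial_deriv i f)))"

definition bilipschitz_on :: "real \<Rightarrow> 'a::metric_space set \<Rightarrow> ('a \<Rightarrow> 'b::metric_space) \<Rightarrow> bool" where
  "bilipschitz_on L S f \<longleftrightarrow> inj_on f S \<and> L-lipschitz_on S f \<and> L-lipschitz_on (f ` S) (inv_into S f)"

text \<open>The index type \<open>'n\<close> carries no order, so the coordinate \<open>k\<close> plays the role of the last
  coordinate \<open>x\<^sub>n\<close>. Permuting coordinates shows that the notion does not depend on \<open>k\<close>.\<close>

definition uniformly_lipschitz_regular :: "'n::finite \<Rightarrow> (real ^ 'n) set \<Rightarrow> bool" where
  "uniformly_lipschitz_regular k D \<longleftrightarrow>
     (\<exists>L. \<forall>x0\<in>frontier D. \<exists>U. \<exists>\<Phi> :: real ^ 'n \<Rightarrow> real ^ 'n.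
        x0 \<in> interior U \<and> \<Phi> 0 = x0 \<and> \<Phi> ` ball 0 1 = U \<and>
        bilipschitz_on L (ball 0 1) \<Phi> \<and>
        \<Phi> ` (ball 0 1 \<inter> {x. x $ k < 0}) = U \<inter> (UNIV - closure D) \<and>
        \<Phi> ` (ball 0 1 \<inter> {x. x $ k > 0}) = U \<inter> D \<and>
        \<Phi> ` (ball 0 1 \<inter> {x. x $ k = 0}) = U \<inter> frontier D)"

text \<open>In the next two definitions \<open>u\<close> has domain \<open>X\<close> and \<open>\<phi>\<close> has domain \<open>Y\<close>.\<close>

definition touches_above ::
  "'a set \<Rightarrow> ('a \<Rightarrow> real) \<Rightarrow> 'a set \<Rightarrow> ('a \<Rightarrow> real) \<Rightarrow> 'a \<Rightarrow> bool" where
  "touches_above X u Y \<phi> x0 \<longleftrightarrow> (\<forall>x\<in>X \<inter> Y. u x \<le> \<phi> x) \<and> u x0 = \<phi> x0"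

definition touches_below ::
  "'a set \<Rightarrow> ('a \<Rightarrow> real) \<Rightarrow> 'a set \<Rightarrow> ('a \<Rightarrow> real) \<Rightarrow> 'a \<Rightarrow> bool" where
  "touches_below X u Y \<phi> x0 \<longleftrightarrow> (\<forall>x\<in>X \<inter> Y. u x \<ge> \<phi> x) \<and> u x0 = \<phi> x0"

definition H_minus :: "(real ^ 'n::finite \<Rightarrow> real) \<Rightarrow> real ^ 'n \<Rightarrow> real" where
  "H_minus \<phi> x = norm (grad \<phi> x) - 1"

definition H_plus :: "(real ^ 'n::finite \<Rightarrow> real) \<Rightarrow> real ^ 'n \<Rightarrow> real" where
  "H_plus \<phi> x = - (1 / 2) * laplacian \<phi> x - 1"

text \<open>The domain of \<open>u\<close> is \<open>closure \<Omega>\<close>, but the equation is tested at points of \<open>\<Omega>\<close> only.\<close>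

definition viscosity_solution ::
  "(real ^ 'n::finite) set \<Rightarrow> (real ^ 'n) set \<Rightarrow> (real ^ 'n) set \<Rightarrow> (real ^ 'n) set \<Rightarrow>
   (real ^ 'n \<Rightarrow> real) \<Rightarrow> bool" where
  "viscosity_solution \<Omega> \<Omega>m \<Omega>p \<Gamma> u \<longleftrightarrow>
     continuous_on (closure \<Omega>) u \<and>
     (\<forall>x0\<in>\<Omega>. \<forall>r>0. \<forall>\<phi>. C2_on (ball x0 r) \<phi> \<and> touches_above (closure \<Omega>) u (ball x0 r) \<phi> x0 \<longrightarrow>
        (x0 \<in> \<Omega>m \<longrightarrow> H_minus \<phi> x0 \<le> 0) \<and>
        (x0 \<in> \<Omega>p \<longrightarrow> H_plus \<phi> x0 \<le> 0) \<and>
        (x0 \<in> \<Gamma> \<longrightarrow> min (H_minus \<phi> x0) (H_plus \<phi> x0) \<le> 0)) \<and>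
     (\<forall>x0\<in>\<Omega>. \<forall>r>0. \<forall>\<phi>. C2_on (ball x0 r) \<phi> \<and> touches_below (closure \<Omega>) u (ball x0 r) \<phi> x0 \<longrightarrow>
        (x0 \<in> \<Omega>m \<longrightarrow> H_minus \<phi> x0 \<ge> 0) \<and>
        (x0 \<in> \<Omega>p \<longrightarrow> H_plus \<phi> x0 \<ge> 0) \<and>
        (x0 \<in> \<Gamma> \<longrightarrow> max (H_minus \<phi> x0) (H_plus \<phi> x0) \<ge> 0))"

end

theory Submission
  imports Defs
begin

text \<open>
  Perron's method. Put \<open>P = \<Omega>\<^sub>+\<close> and let \<open>u\<close> be the supremum of all continuous \<open>v \<ge> 0\<close> that vanish
  outside \<open>\<Omega>\<close>, have local slope at most 1 off \<open>closure P\<close>, and are viscosity subsolutions on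
  \<open>P \<union> \<Gamma>\<close>. The usual bump argument shows that \<open>u\<close> is a solution as soon as it is continuous.
  No comparison principle for the coupled problem is needed for that. Off \<open>closure P\<close> the slope bound
  passes to the supremum, and along bi-Lipschitz charts it gives a uniform Lipschitz bound up to
  \<open>frontier P\<close>. From inside \<open>P\<close>, the charts supply exterior balls near every boundary point at all
  scales, and a radial barrier around such a ball contracts the oscillation at \<open>frontier P\<close> by a
  fixed factor from one scale to the next. Inside \<open>P\<close> the equation is translation invariant, so
  \<open>v (x + h) - \<epsilon>\<close> can be glued into a subsolution wherever \<open>x\<close> and \<open>x + h\<close> are both in \<open>P\<close>, which
  carries the modulus of continuity from the boundary to the interior.
\<close>

subsection \<open>Second-order calculus\<close>

text \<open>The obstacle is that the competitors are not equicontinuous inside \<open>P\<close>: a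
  subsolution there may dip steeply below its boundary values. From above, all competitors obey one
  boundary modulus, by comparison with a barrier. From below, a competitor is instead replaced by a
  larger one, its maximum with a reflected barrier, which keeps all values off \<open>P\<close>. So
  the modulus is two-sided only for the supremum. That is enough, since each estimate ends by
  bounding a competitor by the supremum. Because a lift keeps the values off \<open>P\<close>, lifts
  at different boundary points and scales can be iterated.

  The charts give exterior balls of size comparable to the scale, but in general none that touches
  the boundary point itself. Hence the barrier does not vanish at that point; it only gains a factor
  \<open>\<theta> < 1\<close> per scale, while the Lipschitz bound off \<open>P\<close> pays for
  treating the boundary values as constant.\<close>

definition trace_op :: "(real ^ 'n::finite \<Rightarrow> real ^ 'n) \<Rightarrow> real" where
  "trace_op A = (\<Sum>i\<in>UNIV. A (axis i 1) $ i)"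

text \<open>Gradient and second derivative are explicit witnesses, so that they are computed by the
  \<open>has_derivative\<close> rules instead of through iterated \<open>partial_deriv\<close>.
  Continuity of \<open>H\<close> is asked direction by direction, which in finite dimension is
  continuity of the Hessian.\<close>

definition C2_with ::
  "(real ^ 'n::finite) set \<Rightarrow> (real ^ 'n \<Rightarrow> real) \<Rightarrow> (real ^ 'n \<Rightarrow> real ^ 'n) \<Rightarrow>
   (real ^ 'n \<Rightarrow> real ^ 'n \<Rightarrow> real ^ 'n) \<Rightarrow> bool" where
  "C2_with S f G H \<longleftrightarrow>
     (\<forall>x\<in>S. (f has_derivative (\<lambda>h. G x \<bullet> h)) (at x)) \<and>
     (\<forall>x\<in>S. (G has_derivative H x) (at x)) \<and>
     (\<forall>h. continuous_on S (\<lambda>x. H x h))"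

lemma linear_expand_axis:
  fixes D :: "real ^ 'n::finite \<Rightarrow> real"
  assumes "linear D"
  shows "D h = (\<Sum>i\<in>UNIV. h $ i * D (axis i 1))"
proof -
  have "h = (\<Sum>i\<in>UNIV. h $ i *\<^sub>R axis i 1)"
    unfolding scalar_mult_eq_scaleR[symmetric] by (rule basis_expansion[symmetric])
  then have "D h = D (\<Sum>i\<in>UNIV. h $ i *\<^sub>R axis i 1)" by (rule arg_cong)
  also have "\<dots> = (\<Sum>i\<in>UNIV. h $ i * D (axis i 1))"
    by (simp add: linear_sum[OF assms] linear_cmul[OF assms])
  finally show ?thesis .
qed

lemma has_derivative_vec_nth:
  "(f has_derivative D) F \<Longrightarrow> ((\<lambda>x. f x $ i) has_derivative (\<lambda>h. D h $ i)) F"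
  by (rule bounded_linear.has_derivative[OF bounded_linear_vec_nth])

lemma has_derivative_vec_lambda:
  fixes f :: "'n::finite \<Rightarrow> 'a::real_normed_vector \<Rightarrow> real"
  assumes "\<And>i. (f i has_derivative D i) (at x within S)"
  shows "((\<lambda>x. \<chi> i. f i x) has_derivative (\<lambda>h. \<chi> i. D i h)) (at x within S)"
proof (subst has_derivative_componentwise_within, rule ballI)
  fix b :: "real ^ 'n" assume "b \<in> Basis"
  then obtain i where "b = axis i 1" by (auto simp: Basis_vec_def)
  then show "((\<lambda>x. (\<chi> i. f i x) \<bullet> b) has_derivative (\<lambda>h. (\<chi> i. D i h) \<bullet> b)) (at x within S)"
    using assms by (simp add: inner_axis)
qed

lemma C2_with_subset: "C2_with S f G H \<Longrightarrow> T \<subseteq> S \<Longrightarrow> C2_with T f G H"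
  unfolding C2_with_def by (meson continuous_on_subset subsetD)

lemma C2_with_partial_deriv:
  assumes "C2_with S f G H" "x \<in> S"
  shows "partial_deriv i f x = G x $ i"
proof -
  have "(f has_derivative (\<lambda>h. G x \<bullet> h)) (at x)" using assms by (auto simp: C2_with_def)
  then have "frechet_derivative f (at x) = (\<lambda>h. G x \<bullet> h)"
    by (rule frechet_derivative_at[symmetric])
  then show ?thesis by (simp add: partial_deriv_def inner_axis)
qed

lemma C2_with_partial_deriv2:
  assumes "C2_with S f G H" "open S" "x \<in> S"
  shows "(partial_deriv i f has_derivative (\<lambda>h. H x h $ i)) (at x)"
    and "partial_deriv j (partial_deriv i f) x = H x (axis j 1) $ i"
proof -
  have "((\<lambda>x. G x $ i) has_derivative (\<lambda>h. H x h $ i)) (at x)"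
    using assms by (auto simp: C2_with_def intro!: bounded_linear.has_derivative[OF bounded_linear_vec_nth])
  then show *: "(partial_deriv i f has_derivative (\<lambda>h. H x h $ i)) (at x)"
    using assms C2_with_partial_deriv[OF assms(1)]
    by (auto intro: has_derivative_transform_within_open[of "\<lambda>x. G x $ i" _ _ _ S])
  then have "frechet_derivative (partial_deriv i f) (at x) = (\<lambda>h. H x h $ i)"
    by (rule frechet_derivative_at[symmetric])
  then show "partial_deriv j (partial_deriv i f) x = H x (axis j 1) $ i"
    by (simp add: partial_deriv_def[of j])
qed

lemma C2_with_imp_C2_on:
  assumes "C2_with S f G H" "open S"
  shows "C2_on S f"
  unfolding C2_on_def
proof (intro conjI allI)
  show "f differentiable_on S"
    using assms by (auto simp: C2_with_def differentiable_on_def differentiable_def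
        intro: has_derivative_at_withinI)
  show "partial_deriv i f differentiable_on S" for i
    using C2_with_partial_deriv2(1)[OF assms]
    by (auto simp: differentiable_on_def differentiable_def intro: has_derivative_at_withinI)
  show "continuous_on S (partial_deriv j (partial_deriv i f))" for i j
  proof -
    have "continuous_on S (\<lambda>x. H x (axis j 1) $ i)"
      using assms by (auto simp: C2_with_def intro: continuous_on_component)
    then show ?thesis
      by (rule continuous_on_eq) (simp add: C2_with_partial_deriv2(2)[OF assms])
  qed
qed

lemma C2_with_H:
  assumes "C2_with S f G H" "open S" "x \<in> S"
  shows "H_minus f x = norm (G x) - 1" "H_plus f x = - (1 / 2) * trace_op (H x) - 1"
proof -
  have "grad f x = G x"
    using C2_with_partial_deriv[OF assms(1,3)] by (simp add: grad_def)
  then show "H_minus f x = norm (G x) - 1" by (simp add: H_minus_def)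
  have "laplacian f x = trace_op (H x)"
    using C2_with_partial_deriv2(2)[OF assms] by (simp add: laplacian_def trace_op_def)
  then show "H_plus f x = - (1 / 2) * trace_op (H x) - 1" by (simp add: H_plus_def)
qed

text \<open>Each partial derivative is itself differentiable, so the gradient is differentiable
  coordinatewise. Linearity expresses its derivative in any direction through the second partials,
  whose continuity is given.\<close>

lemma C2_on_imp_C2_with:
  assumes "C2_on S f" "open S"
  obtains H where "C2_with S f (grad f) H"
proof -
  define H where "H x h = (\<chi> i. frechet_derivative (partial_deriv i f) (at x) h)" for x h
  have d: "(partial_deriv i f has_derivative frechet_derivative (partial_deriv i f) (at x)) (at x)"
    if "x \<in> S" for x i
    using assms that
    by (metis C2_on_def differentiable_on_eq_differentiable_at frechet_derivative_works)
  have "(f has_derivative (\<lambda>h. grad f x \<bullet> h)) (at x)" if "x \<in> S" for x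
  proof -
    have df: "(f has_derivative frechet_derivative f (at x)) (at x)"
      using assms that
      by (metis C2_on_def differentiable_on_eq_differentiable_at frechet_derivative_works)
    then have lin: "linear (frechet_derivative f (at x))"
      using has_derivative_linear by blast
    have "frechet_derivative f (at x) h = grad f x \<bullet> h" for h
    proof -
      have "frechet_derivative f (at x) h = (\<Sum>i\<in>UNIV. h $ i * frechet_derivative f (at x) (axis i 1))"
        by (rule linear_expand_axis[OF lin])
      also have "\<dots> = grad f x \<bullet> h"
        by (simp add: grad_def partial_deriv_def inner_vec_def mult.commute)
      finally show ?thesis .
    qed
    then have "frechet_derivative f (at x) = (\<lambda>h. grad f x \<bullet> h)" by auto
    with df show ?thesis by simp
  qed
  moreover have "(grad f has_derivative H x) (at x)" if "x \<in> S" for x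
  proof -
    have "((\<lambda>x. \<chi> i. partial_deriv i f x) has_derivative H x) (at x)"
      unfolding H_def using d[OF that] by (rule has_derivative_vec_lambda)
    then show ?thesis by (simp add: grad_def[abs_def])
  qed
  moreover have "continuous_on S (\<lambda>x. H x h)" for h
  proof -
    have "continuous_on S (\<lambda>x. \<Sum>j\<in>UNIV. h $ j *\<^sub>R partial_deriv j (partial_deriv i f) x)" for i
      using assms(1) by (intro continuous_intros) (auto simp: C2_on_def)
    moreover have "(\<Sum>j\<in>UNIV. h $ j *\<^sub>R partial_deriv j (partial_deriv i f) x) = H x h $ i"
      if "x \<in> S" for i x
    proof -
      let ?D = "frechet_derivative (partial_deriv i f) (at x)"
      have lin: "linear ?D" using d[OF that] has_derivative_linear by blast
      have "?D h = (\<Sum>i\<in>UNIV. h $ i * ?D (axis i 1))" by (rule linear_expand_axis[OF lin])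
      then show ?thesis by (simp add: H_def partial_deriv_def[of _ "partial_deriv i f"])
    qed
    ultimately have "continuous_on S (\<lambda>x. H x h $ i)" for i
      by (rule continuous_on_eq) simp
    then have "continuous_on S (\<lambda>x. \<chi> i. H x h $ i)" by (intro continuous_on_vec_lambda)
    then show ?thesis by simp
  qed
  ultimately have "C2_with S f (grad f) H" by (simp add: C2_with_def)
  then show thesis using that by blast
qed

lemma C2_with_continuous:
  assumes "C2_with S f G H"
  shows "continuous_on S f" "continuous_on S G" "continuous_on S (\<lambda>x. trace_op (H x))"
proof -
  show "continuous_on S f"
    using assms
    by (meson C2_with_def continuous_at_imp_continuous_on has_derivative_continuous)
  show "continuous_on S G"
    using assms
    by (meson C2_with_def continuous_at_imp_continuous_on has_derivative_continuous)
  show "continuous_on S (\<lambda>x. trace_op (H x))"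
    unfolding trace_op_def using assms
    by (intro continuous_on_sum continuous_on_component) (auto simp: C2_with_def)
qed

section \<open>Traces and calculus rules for C2 functions\<close>

lemma trace_op_add: "trace_op (\<lambda>h. A h + B h) = trace_op A + trace_op B"
  by (simp add: trace_op_def sum.distrib)

lemma trace_op_scaleR: "trace_op (\<lambda>h. c *\<^sub>R A h) = c * trace_op A"
  by (simp add: trace_op_def sum_distrib_left)

lemma trace_op_ident: "trace_op (\<lambda>h :: real ^ 'n::finite. h) = CARD('n)"
  by (simp add: trace_op_def)

lemma trace_op_rank_one: "trace_op (\<lambda>h. (b \<bullet> h) *\<^sub>R a) = a \<bullet> b"
  by (simp add: trace_op_def inner_axis) (simp add: inner_vec_def mult.commute)

lemma C2_with_const: "C2_with S (\<lambda>x. c) (\<lambda>x. 0) (\<lambda>x h. 0)"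
  by (simp add: C2_with_def)

lemma C2_with_add:
  assumes "C2_with S f G H" "C2_with S f' G' H'"
  shows "C2_with S (\<lambda>x. f x + f' x) (\<lambda>x. G x + G' x) (\<lambda>x h. H x h + H' x h)"
  using assms unfolding C2_with_def
  by (auto simp: inner_add_left intro!: derivative_eq_intros continuous_intros)

lemma C2_with_cmul:
  assumes "C2_with S f G H"
  shows "C2_with S (\<lambda>x. c * f x) (\<lambda>x. c *\<^sub>R G x) (\<lambda>x h. c *\<^sub>R H x h)"
  using assms unfolding C2_with_def
  by (auto intro!: derivative_eq_intros continuous_intros)

lemma C2_with_affine:
  assumes "C2_with S f G H"
  shows "C2_with S (\<lambda>x. a + c * f x) (\<lambda>x. c *\<^sub>R G x) (\<lambda>x h. c *\<^sub>R H x h)"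
  using C2_with_add[OF C2_with_const C2_with_cmul[OF assms], of a c] by simp

lemma C2_with_shift:
  assumes "C2_with S f G H"
  shows "C2_with ((\<lambda>x. x + a) -` S) (\<lambda>x. f (x + a)) (\<lambda>x. G (x + a)) (\<lambda>x. H (x + a))"
  unfolding C2_with_def
proof (intro conjI ballI allI)
  fix x assume x: "x \<in> (\<lambda>x. x + a) -` S"
  have s: "((\<lambda>x. x + a) has_derivative (\<lambda>h. h)) (at x)"
    by (auto intro!: derivative_eq_intros)
  show "((\<lambda>x. f (x + a)) has_derivative (\<lambda>h. G (x + a) \<bullet> h)) (at x)"
    using has_derivative_compose[OF s, of f] assms x by (auto simp: C2_with_def)
  show "((\<lambda>x. G (x + a)) has_derivative H (x + a)) (at x)"
    using has_derivative_compose[OF s, of G] assms x by (auto simp: C2_with_def)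
next
  fix h
  show "continuous_on ((\<lambda>x. x + a) -` S) (\<lambda>x. H (x + a) h)"
    using assms
    by (intro continuous_on_compose2[of S "\<lambda>x. H x h" _ "\<lambda>x. x + a"] continuous_intros)
      (auto simp: C2_with_def)
qed

lemma C2_with_square:
  "C2_with S (\<lambda>x. (x - z) \<bullet> (x - z)) (\<lambda>x. 2 *\<^sub>R (x - z)) (\<lambda>x h. 2 *\<^sub>R h)"
  unfolding C2_with_def
  by (auto intro!: derivative_eq_intros simp: inner_commute)

lemma C2_with_compose:
  fixes F F1 F2 :: "real \<Rightarrow> real"
  assumes f: "C2_with S f G H"
    and F: "\<And>t. (F has_real_derivative F1 t) (at t)" "\<And>t. (F1 has_real_derivative F2 t) (at t)"
      "continuous_on UNIV F2"
  shows "C2_with S (\<lambda>x. F (f x)) (\<lambda>x. F1 (f x) *\<^sub>R G x)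
    (\<lambda>x h. F2 (f x) *\<^sub>R (G x \<bullet> h) *\<^sub>R G x + F1 (f x) *\<^sub>R H x h)"
  unfolding C2_with_def
proof (intro conjI ballI allI)
  fix x assume x: "x \<in> S"
  have df: "(f has_derivative (\<lambda>h. G x \<bullet> h)) (at x)" and dG: "(G has_derivative H x) (at x)"
    using f x by (auto simp: C2_with_def)
  show "((\<lambda>x. F (f x)) has_derivative (\<lambda>h. (F1 (f x) *\<^sub>R G x) \<bullet> h)) (at x)"
    using has_derivative_compose[OF df F(1)[unfolded has_field_derivative_def]] by simp
  have "((\<lambda>x. F1 (f x)) has_derivative (\<lambda>h. F2 (f x) * (G x \<bullet> h))) (at x)"
    using has_derivative_compose[OF df F(2)[unfolded has_field_derivative_def]] by simp
  from has_derivative_scaleR[OF this dG]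
  show "((\<lambda>x. F1 (f x) *\<^sub>R G x) has_derivative
      (\<lambda>h. F2 (f x) *\<^sub>R (G x \<bullet> h) *\<^sub>R G x + F1 (f x) *\<^sub>R H x h)) (at x)"
    by (simp add: add.commute)
next
  fix h
  have "continuous_on S (\<lambda>x. F2 (f x))" "continuous_on S (\<lambda>x. F1 (f x))"
    using C2_with_continuous(1)[OF f] F(2,3)
    by (auto intro!: continuous_on_compose2[of UNIV F2 S f] continuous_on_compose2[of UNIV F1 S f]
        DERIV_continuous_on[of UNIV F1])
  then show "continuous_on S (\<lambda>x. F2 (f x) *\<^sub>R (G x \<bullet> h) *\<^sub>R G x + F1 (f x) *\<^sub>R H x h)"
    using C2_with_continuous(2)[OF f] f by (intro continuous_intros) (auto simp: C2_with_def)
qed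

text \<open>One coordinate line at a time: a negative diagonal entry of the second derivative would
  push the \<open>i\<close>-th partial derivative below 0 just beyond \<open>x\<close>, and the mean
  value theorem would make \<open>f\<close> drop there.\<close>

lemma C2_with_local_min:
  assumes f: "C2_with S f G H" and S: "open S" "x \<in> S"
    and min: "\<forall>\<^sub>F y in nhds x. f x \<le> f y"
  shows "G x = 0" "0 \<le> trace_op (H x)"
proof -
  have df: "(f has_derivative (\<lambda>h. G y \<bullet> h)) (at y)" if "y \<in> S" for y
    using f that by (auto simp: C2_with_def)
  obtain d where d: "d > 0" "ball x d \<subseteq> S" "\<And>y. y \<in> ball x d \<Longrightarrow> f x \<le> f y"
  proof -
    obtain d1 where "d1 > 0" "ball x d1 \<subseteq> S" using S openE by blast
    moreover obtain d2 where "d2 > 0" "\<And>y. dist y x < d2 \<Longrightarrow> f x \<le> f y"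
      using min by (auto simp: eventually_nhds_metric)
    ultimately show ?thesis
      using that[of "min d1 d2"] by (fastforce simp: dist_commute)
  qed
  have "(\<lambda>h. G x \<bullet> h) = (\<lambda>h. 0)"
    using has_derivative_local_min[OF df[OF S(2)]] min eventually_nhds_conv_at by blast
  then have "G x \<bullet> G x = 0" by meson
  then show G0: "G x = 0" by simp
  have "0 \<le> H x (axis i 1) $ i" for i
  proof (rule ccontr)
    assume neg: "\<not> 0 \<le> H x (axis i 1) $ i"
    define \<gamma> where "\<gamma> t = x + t *\<^sub>R axis i (1::real)" for t
    have \<gamma>': "(\<gamma> has_derivative (\<lambda>h. h *\<^sub>R axis i 1)) (at t)" for t
      unfolding \<gamma>_def by (auto intro!: derivative_eq_intros)
    have \<gamma>in: "\<gamma> t \<in> ball x d" if "\<bar>t\<bar> < d" for t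
      using that by (simp add: \<gamma>_def dist_norm)
    have g: "((\<lambda>t. f (\<gamma> t)) has_real_derivative G (\<gamma> t) $ i) (at t)" if "\<bar>t\<bar> < d" for t
    proof -
      have "((\<lambda>t. f (\<gamma> t)) has_derivative (\<lambda>h. G (\<gamma> t) \<bullet> (h *\<^sub>R axis i 1))) (at t)"
        by (rule has_derivative_compose[OF \<gamma>' df]) (use \<gamma>in that d in auto)
      then show ?thesis
        by (simp add: has_field_derivative_def inner_axis mult_commute_abs)
    qed
    have "((\<lambda>t. G (\<gamma> t) $ i) has_derivative (\<lambda>h. H x (h *\<^sub>R axis i 1) $ i)) (at 0)"
    proof (rule has_derivative_vec_nth, rule has_derivative_compose[OF \<gamma>'])
      show "(G has_derivative H x) (at (\<gamma> 0))"
        using f S by (simp add: C2_with_def \<gamma>_def)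
    qed
    moreover have "H x (h *\<^sub>R axis i 1) = h *\<^sub>R H x (axis i 1)" for h
      using f S by (metis C2_with_def has_derivative_linear linear_cmul)
    ultimately have "((\<lambda>t. G (\<gamma> t) $ i) has_real_derivative H x (axis i 1) $ i) (at 0)"
      by (simp add: has_field_derivative_def mult_commute_abs)
    from has_real_derivative_neg_dec_right[OF this] neg
    obtain e where e: "e > 0" "\<And>h. 0 < h \<Longrightarrow> h < e \<Longrightarrow> G (\<gamma> h) $ i < G (\<gamma> 0) $ i"
      by auto
    define t where "t = min d e / 2"
    have t: "0 < t" "t < d" "t < e" using d e by (auto simp: t_def min_def)
    obtain s where s: "0 < s" "s < t" "f (\<gamma> t) - f (\<gamma> 0) = (t - 0) * (G (\<gamma> s) $ i)"
      using MVT2[of 0 t "\<lambda>t. f (\<gamma> t)" "\<lambda>t. G (\<gamma> t) $ i"] t g by auto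
    have "G (\<gamma> s) $ i < 0" using e(2)[of s] s t G0 by (simp add: \<gamma>_def)
    then have "f (\<gamma> t) < f (\<gamma> 0)"
      using s t by (metis diff_less_0_iff_less diff_zero mult_pos_neg)
    then show False using d(3)[OF \<gamma>in, of t] t by (simp add: \<gamma>_def)
  qed
  then show "0 \<le> trace_op (H x)" by (simp add: trace_op_def sum_nonneg)
qed

text \<open>An exponential profile is used instead of a power of the distance because it is smooth
  also at the centre.\<close>

lemma annulus_barrier:
  fixes c :: real
  assumes c: "0 < c" "c \<le> 1/8"
  obtains \<theta> K where "0 < \<theta>" "\<theta> < 1" "0 < K"
    "\<And>(z :: real ^ 'n::finite) r. 0 < r \<Longrightarrow> \<exists>\<psi> G H. C2_with UNIV \<psi> G H \<and>
       (\<forall>x. c * r \<le> dist x z \<longrightarrow> 0 \<le> \<psi> x) \<and>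
       (\<forall>x. dist x z = r/2 \<longrightarrow> \<psi> x = 1) \<and>
       (\<forall>x. dist x z \<le> 3*r/8 \<longrightarrow> \<psi> x \<le> \<theta>) \<and>
       (\<forall>x. c * r \<le> dist x z \<and> dist x z \<le> r/2 \<longrightarrow> K * r^2 * trace_op (H x) < -2)"
proof -
  define n where "n = real CARD('n)"
  \<comment> \<open>\<open>\<alpha>\<close> is tied to the inner radius: from distance
    \<open>c * r\<close> outward, \<open>a * q x\<close> is at least \<open>n\<close>, so the radial
    term \<open>4 * (a * q x)\<close> of the Laplacian dominates the dimensional term
    \<open>2 * n\<close>.\<close>
  define \<alpha> where "\<alpha> = n / c^2"
  \<comment> \<open>\<open>D\<close> normalises the profile to rise from 0 at distance
    \<open>c * r\<close> to 1 at \<open>r/2\<close>. \<open>\<theta>\<close> is its value at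
    \<open>3*r/8\<close>, and 3/8 = 1/4 + 1/8 adds the offset of the exterior ball's centre to the
    radius of the next smaller ball. \<open>K\<close> bounds the scaled trace by -4, twice what is
    asked.\<close>
  define D where "D = exp (- \<alpha> * c^2) - exp (- \<alpha> * (1/2)^2)"
  define \<theta> where "\<theta> = (exp (- \<alpha> * c^2) - exp (- \<alpha> * (3/8)^2)) / D"
  define K where "K = 2 * D * exp (\<alpha>/4) / (\<alpha> * n)"
  have n: "n > 0" by (simp add: n_def)
  have \<alpha>: "\<alpha> > 0" using n c by (simp add: \<alpha>_def)
  have c2: "c^2 < (3/8)^2" "c^2 < (1/2)^2" using c by (auto intro!: power_strict_mono)
  have D: "D > 0" using \<alpha> c2 unfolding D_def by simp
  have "0 < \<theta>" using \<alpha> c2 D unfolding \<theta>_def by (intro divide_pos_pos) simp_all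
  moreover have "\<theta> < 1" using \<alpha> D unfolding \<theta>_def by (simp add: D_def field_simps)
  moreover have "0 < K" using D \<alpha> n by (simp add: K_def)
  moreover have "\<exists>\<psi> G H. C2_with UNIV \<psi> G H \<and>
       (\<forall>x. c * r \<le> dist x z \<longrightarrow> 0 \<le> \<psi> x) \<and>
       (\<forall>x. dist x z = r/2 \<longrightarrow> \<psi> x = 1) \<and>
       (\<forall>x. dist x z \<le> 3*r/8 \<longrightarrow> \<psi> x \<le> \<theta>) \<and>
       (\<forall>x. c * r \<le> dist x z \<and> dist x z \<le> r/2 \<longrightarrow> K * r^2 * trace_op (H x) < -2)"
    if r: "0 < r" for z :: "real ^ 'n" and r
  proof -
    \<comment> \<open>Dividing by \<open>r^2\<close> makes the profile a function of
      \<open>dist x z / r\<close>, which is why \<open>\<theta>\<close> and \<open>K\<close> do not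
      depend on the scale.\<close>
    define a where "a = \<alpha> / r^2"
    have a: "a > 0" using \<alpha> r by (simp add: a_def)
    define q where "q x = (x - z) \<bullet> (x - z)" for x
    have q: "q x = (dist x z)^2" for x by (simp add: q_def dist_norm power2_norm_eq_inner)
    have aq: "a * (s * r)^2 = \<alpha> * s^2" for s using r by (simp add: a_def power_mult_distrib)
    define \<psi> where "\<psi> x = exp (- \<alpha> * c^2) / D + (- 1 / D) * exp (- a * q x)" for x
    define G where "G x = (- 1 / D) *\<^sub>R (- a * exp (- a * q x)) *\<^sub>R 2 *\<^sub>R (x - z)" for x
    define H where "H x h = (- 1 / D) *\<^sub>R
      ((a^2 * exp (- a * q x)) *\<^sub>R ((2 *\<^sub>R (x - z)) \<bullet> h) *\<^sub>R 2 *\<^sub>R (x - z)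
        + (- a * exp (- a * q x)) *\<^sub>R 2 *\<^sub>R h)" for x h
    have "C2_with UNIV (\<lambda>x. exp (- a * ((x - z) \<bullet> (x - z))))
        (\<lambda>x. (- a * exp (- a * ((x - z) \<bullet> (x - z)))) *\<^sub>R (2 *\<^sub>R (x - z)))
        (\<lambda>x h. (a^2 * exp (- a * ((x - z) \<bullet> (x - z)))) *\<^sub>R ((2 *\<^sub>R (x - z)) \<bullet> h) *\<^sub>R (2 *\<^sub>R (x - z))
        + (- a * exp (- a * ((x - z) \<bullet> (x - z)))) *\<^sub>R (2 *\<^sub>R h))"
      by (rule C2_with_compose[OF C2_with_square, where F = "\<lambda>t. exp (- a * t)"])
        (auto intro!: derivative_eq_intros continuous_intros simp: power2_eq_square)
    from C2_with_affine[OF this, of "exp (- \<alpha> * c^2) / D" "- 1 / D"]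
    have C2: "C2_with UNIV \<psi> G H"
      unfolding \<psi>_def[abs_def] G_def[abs_def] H_def[abs_def] q_def by simp
    have \<psi>: "\<psi> x = (exp (- \<alpha> * c^2) - exp (- a * q x)) / D" for x
      by (simp add: \<psi>_def diff_divide_distrib)
    have 1: "0 \<le> \<psi> x" if "c * r \<le> dist x z" for x
    proof -
      have "(c * r)^2 \<le> q x" unfolding q using that c r by (intro power_mono) auto
      then have "\<alpha> * c^2 \<le> a * q x" using aq[of c] a by (metis mult_left_mono less_imp_le)
      then show ?thesis using D by (simp add: \<psi>)
    qed
    have 2: "\<psi> x = 1" if "dist x z = r/2" for x
    proof -
      have "a * q x = \<alpha> * (1/2)^2" using aq[of "1/2"] by (simp only: q that) simp
      then have "\<psi> x = D / D" by (simp only: \<psi> D_def mult_minus_left)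
      then show ?thesis using D by simp
    qed
    have 3: "\<psi> x \<le> \<theta>" if "dist x z \<le> 3*r/8" for x
    proof -
      have "q x \<le> (3/8 * r)^2" unfolding q using that by (intro power_mono) auto
      then have "a * q x \<le> \<alpha> * (3/8)^2" using aq[of "3/8"] a by (metis mult_left_mono less_imp_le)
      then show ?thesis using D unfolding \<psi> \<theta>_def by (intro divide_right_mono) auto
    qed
    have 4: "K * r^2 * trace_op (H x) < -2" if x: "c * r \<le> dist x z" "dist x z \<le> r/2" for x
    proof -
      have "trace_op (H x) = (- 1 / D) * ((a^2 * exp (- a * q x)) * (4 * q x)
          + (- a * exp (- a * q x)) * (2 * n))"
        unfolding H_def[abs_def] trace_op_scaleR trace_op_add trace_op_rank_one trace_op_ident
        by (simp add: q_def n_def trace_op_ident)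
      also have "\<dots> = - (a * exp (- a * q x)) / D * (4 * (a * q x) - 2 * n)"
        by (simp add: algebra_simps power2_eq_square add_divide_distrib diff_divide_distrib)
      finally have t: "trace_op (H x) = - (a * exp (- a * q x)) / D * (4 * (a * q x) - 2 * n)" .
      have "(c * r)^2 \<le> q x" unfolding q using x c r by (intro power_mono) auto
      then have "\<alpha> * c^2 \<le> a * q x" using aq[of c] a by (metis mult_left_mono less_imp_le)
      moreover have "\<alpha> * c^2 = n" using c by (simp add: \<alpha>_def)
      ultimately have n2: "2 * n \<le> 4 * (a * q x) - 2 * n" by simp
      have "q x \<le> (1/2 * r)^2" unfolding q using x by (intro power_mono) auto
      then have "a * q x \<le> \<alpha> * (1/2)^2" using aq[of "1/2"] a by (metis mult_left_mono less_imp_le)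
      then have e: "exp (- (\<alpha>/4)) \<le> exp (- a * q x)" by (simp add: power2_eq_square)
      have "(a * exp (- (\<alpha>/4))) / D * (2 * n) \<le> (a * exp (- a * q x)) / D * (4 * (a * q x) - 2 * n)"
        using e n2 a D n by (intro mult_mono divide_right_mono mult_left_mono) auto
      then have "trace_op (H x) \<le> - ((a * exp (- (\<alpha>/4))) / D * (2 * n))" by (simp add: t)
      then have "K * r^2 * trace_op (H x) \<le> K * r^2 * (- ((a * exp (- (\<alpha>/4))) / D * (2 * n)))"
        using \<open>0 < K\<close> by (intro mult_left_mono) auto
      also have "\<dots> = - 4"
        using r D \<alpha> n by (simp add: K_def a_def exp_minus field_simps)
      finally show ?thesis by simp
    qed
    show ?thesis using C2 1 2 3 4 by blast
  qed
  ultimately show thesis using that by blast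
qed

subsection \<open>Slopes and bi-Lipschitz charts\<close>

text \<open>The metric form of \<open>|Dv| \<le> 1\<close>. The constant 1 is required on a whole
  neighbourhood and not just in the limit, so that the bounds add up along paths exactly.\<close>

definition slope1 :: "('a::metric_space \<Rightarrow> real) \<Rightarrow> 'a \<Rightarrow> bool" where
  "slope1 v x \<longleftrightarrow> (\<forall>\<^sub>F y in nhds x. \<bar>v y - v x\<bar> \<le> dist y x)"

text \<open>Bisection: the bound is additive over adjacent intervals, and on a short interval around
  \<open>x\<close> it holds because both endpoints can be compared with \<open>x\<close>
  itself.\<close>

lemma slope1_along_path:
  fixes \<gamma> :: "real \<Rightarrow> 'a::metric_space"
  assumes ab: "a \<le> b" and slope: "\<And>t. t \<in> {a..b} \<Longrightarrow> slope1 v (\<gamma> t)"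
    and lip: "K-lipschitz_on {a..b} \<gamma>"
  shows "\<bar>v (\<gamma> b) - v (\<gamma> a)\<bar> \<le> K * (b - a)"
proof -
  let ?P = "\<lambda>s t. a \<le> s \<and> s \<le> t \<and> t \<le> b \<longrightarrow> \<bar>v (\<gamma> t) - v (\<gamma> s)\<bar> \<le> K * (t - s)"
  have K: "0 \<le> K" using lip by (rule lipschitz_on_nonneg)
  have "?P a b"
  proof (rule Bolzano[where P = ?P, OF ab])
    fix s t r assume "?P s t" "?P t r" "s \<le> t" "t \<le> r"
    then show "?P s r" by (auto simp: algebra_simps)
  next
    fix x assume x: "a \<le> x" "x \<le> b"
    then have "slope1 v (\<gamma> x)" using slope by simp
    then obtain e where e: "e > 0" "\<And>y. dist y (\<gamma> x) < e \<Longrightarrow> \<bar>v y - v (\<gamma> x)\<bar> \<le> dist y (\<gamma> x)"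
      by (auto simp: slope1_def eventually_nhds_metric)
    \<comment> \<open>\<open>K + 1\<close> instead of \<open>K\<close> keeps the quotient positive
      when the path is constant.\<close>
    have step: "\<bar>v (\<gamma> t) - v (\<gamma> x)\<bar> \<le> K * \<bar>t - x\<bar>"
      if "t \<in> {a..b}" "\<bar>t - x\<bar> < e / (K + 1)" for t
    proof -
      have d: "dist (\<gamma> t) (\<gamma> x) \<le> K * \<bar>t - x\<bar>"
        using lipschitz_onD[OF lip, of t x] that x by (simp add: dist_real_def)
      also have "\<dots> \<le> (K + 1) * \<bar>t - x\<bar>" by (simp add: algebra_simps)
      also have "\<dots> < e" using that K by (simp add: field_simps)
      finally show ?thesis using e(2) d by force
    qed
    have "?P s t" if st: "s \<le> x \<and> x \<le> t \<and> t - s < e / (K + 1)" for s t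
    proof
      assume "a \<le> s \<and> s \<le> t \<and> t \<le> b"
      then have "\<bar>v (\<gamma> t) - v (\<gamma> x)\<bar> \<le> K * \<bar>t - x\<bar>" "\<bar>v (\<gamma> s) - v (\<gamma> x)\<bar> \<le> K * \<bar>s - x\<bar>"
        using st by (intro step; simp)+
      then have "\<bar>v (\<gamma> t) - v (\<gamma> s)\<bar> \<le> K * \<bar>t - x\<bar> + K * \<bar>s - x\<bar>" by linarith
      also have "\<dots> = K * (t - s)" using st by (simp add: algebra_simps)
      finally show "\<bar>v (\<gamma> t) - v (\<gamma> s)\<bar> \<le> K * (t - s)" .
    qed
    then show "\<exists>d>0. \<forall>s t. s \<le> x \<and> x \<le> t \<and> t - s < d \<longrightarrow> ?P s t"
      using e(1) K by (intro exI[of _ "e / (K + 1)"]) auto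
  qed
  then show ?thesis using ab by simp
qed

lemma slope1_convex:
  fixes v :: "'a::real_normed_vector \<Rightarrow> real"
  assumes "convex B" "\<And>x. x \<in> B \<Longrightarrow> slope1 v x" "x \<in> B" "y \<in> B"
  shows "\<bar>v y - v x\<bar> \<le> dist y x"
proof -
  define \<gamma> where "\<gamma> t = x + t *\<^sub>R (y - x)" for t :: real
  have in_B: "\<gamma> t \<in> B" if "t \<in> {0..1}" for t
  proof -
    have "\<gamma> t = (1 - t) *\<^sub>R x + t *\<^sub>R y" by (simp add: \<gamma>_def algebra_simps)
    then show ?thesis using assms that by (auto intro: convexD)
  qed
  have "(dist y x)-lipschitz_on {0..1} \<gamma>"
    by (rule lipschitz_onI)
      (auto simp: \<gamma>_def dist_norm norm_minus_commute mult.commute simp flip: scaleR_left_diff_distrib)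
  from slope1_along_path[OF _ _ this, of v] show ?thesis using assms(2) in_B by (simp add: \<gamma>_def)
qed

text \<open>Walking from \<open>x\<close> against the gradient, \<open>f\<close> would fall faster
  than at rate 1, while \<open>v\<close> can fall at most at rate 1 and stays below
  \<open>f\<close>.\<close>

lemma slope1_touch_above:
  assumes v: "slope1 v x" and f: "C2_with S f G H" and S: "open S" "x \<in> S"
    and touch: "\<forall>\<^sub>F y in nhds x. v y \<le> f y" "v x = f x"
  shows "norm (G x) \<le> 1"
proof (rule ccontr)
  assume G: "\<not> norm (G x) \<le> 1"
  define \<gamma> where "\<gamma> t = x - t *\<^sub>R sgn (G x)" for t :: real
  have \<gamma>': "(\<gamma> has_derivative (\<lambda>h. - h *\<^sub>R sgn (G x))) (at 0)"
    unfolding \<gamma>_def by (auto intro!: derivative_eq_intros)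
  have df: "(f has_derivative (\<lambda>h. G x \<bullet> h)) (at (\<gamma> 0))"
    using f S by (auto simp: C2_with_def \<gamma>_def)
  have GG: "G x \<bullet> sgn (G x) = norm (G x)"
  proof -
    have "G x \<noteq> 0" using G by auto
    then show ?thesis by (simp add: sgn_div_norm dot_square_norm power2_eq_square)
  qed
  have "((\<lambda>t. f (\<gamma> t)) has_real_derivative - norm (G x)) (at 0)"
  proof -
    have "(\<lambda>h. G x \<bullet> (- h *\<^sub>R sgn (G x))) = (*) (- norm (G x))"
      by (simp add: fun_eq_iff GG)
    then show ?thesis
      using has_derivative_compose[OF \<gamma>' df] by (simp add: has_field_derivative_def \<gamma>_def)
  qed
  then have "((\<lambda>t. f (\<gamma> t) + t) has_real_derivative - norm (G x) + 1) (at 0)"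
    by (auto intro!: derivative_eq_intros)
  from has_real_derivative_neg_dec_right[OF this] G
  obtain e where e: "e > 0" "\<And>h. 0 < h \<Longrightarrow> h < e \<Longrightarrow> f (\<gamma> h) + h < f (\<gamma> 0)"
    by auto
  obtain d where d: "d > 0" "\<And>y. dist y x < d \<Longrightarrow> v y \<le> f y \<and> \<bar>v y - v x\<bar> \<le> dist y x"
    using eventually_conj[OF touch(1) v[unfolded slope1_def]] by (auto simp: eventually_nhds_metric)
  define t where "t = min e d / 2"
  have t: "0 < t" "t < e" "t < d" using e d by (auto simp: t_def)
  have "norm (sgn (G x)) = 1" using G by (auto simp: norm_sgn)
  then have dist: "dist (\<gamma> t) x = t" using t by (simp add: \<gamma>_def dist_norm)
  have "f (\<gamma> t) + t < f x" using e(2)[of t] t by (simp add: \<gamma>_def)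
  moreover have "v (\<gamma> t) \<le> f (\<gamma> t)" "\<bar>v (\<gamma> t) - v x\<bar> \<le> t" using d(2)[of "\<gamma> t"] dist t by auto
  ultimately show False using touch(2) by linarith
qed

text \<open>Strictness leaves the margin \<open>1 - norm (G x)\<close>, which absorbs the
  first-order remainder near \<open>x\<close>.\<close>

lemma slope1_C2:
  assumes f: "C2_with S f G H" and S: "x \<in> S" and G: "norm (G x) < 1"
  shows "slope1 f x"
proof -
  have "(f has_derivative (\<lambda>h. G x \<bullet> h)) (at x)" using f S by (auto simp: C2_with_def)
  then have "\<forall>\<^sub>F y in at x. norm (f y - f x - G x \<bullet> (y - x)) \<le> (1 - norm (G x)) * norm (y - x)"
    using G unfolding has_derivative_within_alt2 by simp
  then have "\<forall>\<^sub>F y in at x. \<bar>f y - f x\<bar> \<le> dist y x"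
  proof eventually_elim
    case (elim y)
    moreover have "\<bar>G x \<bullet> (y - x)\<bar> \<le> norm (G x) * norm (y - x)" by (rule Cauchy_Schwarz_ineq2)
    ultimately show ?case
      unfolding dist_norm left_diff_distrib real_norm_def by linarith
  qed
  then show ?thesis unfolding slope1_def by (simp add: eventually_nhds_conv_at)
qed

section \<open>Uniform charts and exterior geometry\<close>

text \<open>A quantitative form of the chart: the covered ball has radius \<open>1 / (2*L)\<close>
  at every boundary point, whereas the regularity condition only says
  \<open>x0 \<in> interior U\<close>. The inverse bound is stated directly on pairs of points,
  without \<open>inv_into\<close>.\<close>

definition half_ball_chart ::
  "'n::finite \<Rightarrow> (real ^ 'n) set \<Rightarrow> real \<Rightarrow> real ^ 'n \<Rightarrow> (real ^ 'n \<Rightarrow> real ^ 'n) \<Rightarrow> bool" where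
  "half_ball_chart k D L y \<Phi> \<longleftrightarrow> \<Phi> 0 = y \<and> L-lipschitz_on (ball 0 1) \<Phi> \<and>
       (\<forall>a\<in>ball 0 1. \<forall>b\<in>ball 0 1. dist a b \<le> L * dist (\<Phi> a) (\<Phi> b)) \<and>
       ball y (1 / (2*L)) \<subseteq> \<Phi> ` ball 0 1 \<and>
       (\<forall>a\<in>ball 0 1. (a $ k < 0 \<longrightarrow> \<Phi> a \<notin> closure D) \<and> (0 < a $ k \<longrightarrow> \<Phi> a \<in> D))"

lemma regular_chart:
  fixes D :: "(real ^ 'n::finite) set"
  assumes "uniformly_lipschitz_regular k D"
  obtains L where "L \<ge> 1"
    "\<And>y. y \<in> frontier D \<Longrightarrow> \<exists>\<Phi>. half_ball_chart k D L y \<Phi>"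
proof -
  from assms[unfolded uniformly_lipschitz_regular_def] obtain L0 where L0: "\<forall>x0\<in>frontier D. \<exists>U. \<exists>\<Phi> :: real ^ 'n \<Rightarrow> real ^ 'n.
        x0 \<in> interior U \<and> \<Phi> 0 = x0 \<and> \<Phi> ` ball 0 1 = U \<and>
        bilipschitz_on L0 (ball 0 1) \<Phi> \<and>
        \<Phi> ` (ball 0 1 \<inter> {x. x $ k < 0}) = U \<inter> (UNIV - closure D) \<and>
        \<Phi> ` (ball 0 1 \<inter> {x. x $ k > 0}) = U \<inter> D \<and>
        \<Phi> ` (ball 0 1 \<inter> {x. x $ k = 0}) = U \<inter> frontier D" ..
  define L where "L = max L0 1"
  have L: "L \<ge> 1" by (simp add: L_def)
  show thesis
  proof (rule that[OF L])
    fix y assume "y \<in> frontier D"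
    from bspec[OF L0 this] obtain U where "\<exists>\<Phi> :: real ^ 'n \<Rightarrow> real ^ 'n. y \<in> interior U \<and> \<Phi> 0 = y \<and> \<Phi> ` ball 0 1 = U \<and>
        bilipschitz_on L0 (ball 0 1) \<Phi> \<and>
        \<Phi> ` (ball 0 1 \<inter> {x. x $ k < 0}) = U \<inter> (UNIV - closure D) \<and>
        \<Phi> ` (ball 0 1 \<inter> {x. x $ k > 0}) = U \<inter> D \<and>
        \<Phi> ` (ball 0 1 \<inter> {x. x $ k = 0}) = U \<inter> frontier D" ..
    then obtain \<Phi> :: "real ^ 'n \<Rightarrow> real ^ 'n" where
      "y \<in> interior U \<and> \<Phi> 0 = y \<and> \<Phi> ` ball 0 1 = U \<and>
        bilipschitz_on L0 (ball 0 1) \<Phi> \<and>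
        \<Phi> ` (ball 0 1 \<inter> {x. x $ k < 0}) = U \<inter> (UNIV - closure D) \<and>
        \<Phi> ` (ball 0 1 \<inter> {x. x $ k > 0}) = U \<inter> D \<and>
        \<Phi> ` (ball 0 1 \<inter> {x. x $ k = 0}) = U \<inter> frontier D" ..
    then have \<Phi>0: "\<Phi> 0 = y"
      and bi: "bilipschitz_on L0 (ball 0 1) \<Phi>"
      and neg: "\<Phi> ` (ball 0 1 \<inter> {x. x $ k < 0}) = \<Phi> ` ball 0 1 \<inter> (UNIV - closure D)"
      and pos: "\<Phi> ` (ball 0 1 \<inter> {x. x $ k > 0}) = \<Phi> ` ball 0 1 \<inter> D"
      by auto
    have inj: "inj_on \<Phi> (ball 0 1)" using bi by (simp add: bilipschitz_on_def)
    have lip: "L-lipschitz_on (ball 0 1) \<Phi>"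
      using bi lipschitz_on_mono[of L0 "ball 0 1" \<Phi> "ball 0 1" L]
      by (simp add: bilipschitz_on_def L_def)
    have inv: "dist a b \<le> L * dist (\<Phi> a) (\<Phi> b)" if "a \<in> ball 0 1" "b \<in> ball 0 1" for a b
    proof -
      have "L0-lipschitz_on (\<Phi> ` ball 0 1) (inv_into (ball 0 1) \<Phi>)"
        using bi by (simp add: bilipschitz_on_def)
      from lipschitz_onD[OF this, of "\<Phi> a" "\<Phi> b"] have "dist a b \<le> L0 * dist (\<Phi> a) (\<Phi> b)"
        using that inj by simp
      also have "\<dots> \<le> L * dist (\<Phi> a) (\<Phi> b)" by (intro mult_right_mono) (auto simp: L_def)
      finally show ?thesis .
    qed
    have cont: "continuous_on (ball 0 1) \<Phi>" using lip by (rule lipschitz_on_continuous_on)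
    have sub: "ball 0 (1/2) \<subseteq> ball (0 :: real ^ 'n) 1" "cball 0 (1/2) \<subseteq> ball (0 :: real ^ 'n) 1"
      by auto
    \<comment> \<open>The image of the open half-size ball is open by invariance of domain, and the
      complement of the image of the closed one is open too. Together they cover the ball around
      \<open>y\<close>, since points of norm 1/2 are sent at least \<open>1 / (2*L)\<close> away
      from \<open>y\<close>. Connectedness leaves only the first set.\<close>
    have "ball y (1 / (2*L)) \<subseteq> \<Phi> ` ball 0 (1/2)"
    proof (rule ccontr)
      assume not_sub: "\<not> ball y (1 / (2*L)) \<subseteq> \<Phi> ` ball 0 (1/2)"
      let ?A = "\<Phi> ` ball 0 (1/2)" and ?B = "- \<Phi> ` cball 0 (1/2)"
      have open_A: "open ?A"
        using inj cont sub
        by (intro invariance_of_domain) (auto intro: continuous_on_subset inj_on_subset)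
      have open_B: "open ?B"
        using cont sub
        by (intro open_Compl compact_imp_closed compact_continuous_image)
          (auto intro: continuous_on_subset)
      have AB: "ball y (1 / (2*L)) \<subseteq> ?A \<union> ?B"
      proof
        fix w assume w: "w \<in> ball y (1 / (2*L))"
        show "w \<in> ?A \<union> ?B"
        proof (cases "w \<in> \<Phi> ` cball 0 (1/2)")
          case True
          then obtain a where a: "a \<in> cball 0 (1/2)" "w = \<Phi> a" by auto
          then have "a \<in> ball 0 1" using sub by blast
          then have "norm a \<le> L * dist (\<Phi> a) y" using inv[of a 0] \<Phi>0 by simp
          also have "\<dots> < 1/2" using w a L by (simp add: dist_commute field_simps)
          finally show ?thesis using a by auto
        qed simp
      qed
      have disj: "?A \<inter> ?B \<inter> ball y (1 / (2*L)) = {}" by auto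
      have y: "y \<in> ?A" "y \<in> ball y (1 / (2*L))"
        using \<Phi>0 L by (auto intro!: image_eqI[of _ _ 0])
      have "?A \<inter> ball y (1 / (2*L)) = {} \<or> ?B \<inter> ball y (1 / (2*L)) = {}"
        using connectedD[OF _ open_A open_B disj AB] by simp
      then show False using y not_sub AB by blast
    qed
    then have ball: "ball y (1 / (2*L)) \<subseteq> \<Phi> ` ball 0 1" using sub by blast
    have "(a $ k < 0 \<longrightarrow> \<Phi> a \<notin> closure D) \<and> (0 < a $ k \<longrightarrow> \<Phi> a \<in> D)" if "a \<in> ball 0 1" for a
      using neg pos that by blast
    with \<Phi>0 lip inv ball show "\<exists>\<Phi>. half_ball_chart k D L y \<Phi>"
      unfolding half_ball_chart_def by blast
  qed
qed

text \<open>The lower half of a chart lies outside \<open>closure D\<close>. A point pushed into it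
  yields an exterior ball of comparable size. Segments in it have images of controlled length in the
  region where the slope bound holds, which costs one factor \<open>L\<close> for the length and
  another for measuring it against \<open>dist x y\<close>.\<close>

lemma regular_exterior:
  fixes D :: "(real ^ 'n::finite) set"
  assumes "uniformly_lipschitz_regular k D"
  obtains c r0 C where "0 < c" "c \<le> 1/8" "0 < r0" "r0 \<le> 1" "0 \<le> C"
    "\<And>y r. y \<in> frontier D \<Longrightarrow> 0 < r \<Longrightarrow> r \<le> r0 \<Longrightarrow>
       \<exists>z. dist z y \<le> r/4 \<and> ball z (c * r) \<inter> closure D = {}"
    "\<And>v x y. continuous_on UNIV v \<Longrightarrow> (\<And>x. x \<notin> closure D \<Longrightarrow> slope1 v x) \<Longrightarrow>
       y \<in> frontier D \<Longrightarrow> x \<notin> D \<Longrightarrow> dist x y < r0 \<Longrightarrow> \<bar>v x - v y\<bar> \<le> C * dist x y"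
proof -
  obtain L where L: "L \<ge> 1"
    and chart: "\<And>y. y \<in> frontier D \<Longrightarrow> \<exists>\<Phi>. half_ball_chart k D L y \<Phi>"
    using regular_chart[OF assms] by blast
  have L2: "L * L \<ge> 1" using L mult_mono[of 1 L 1 L] by simp
  define e :: "real ^ 'n" where "e = axis k 1"
  have e: "norm e = 1" "e $ k = 1" by (simp_all add: e_def)
  show thesis
  proof (rule that[of "1 / (8 * (L * L))" "1 / (2*L)" "L * L"])
    fix y r assume y: "y \<in> frontier D" and r: "0 < r" "r \<le> 1 / (2*L)"
    from chart[OF y] obtain \<Phi> where "half_ball_chart k D L y \<Phi>" by blast
    then have \<Phi>: "\<Phi> 0 = y" "L-lipschitz_on (ball 0 1) \<Phi>"
       "\<And>a b. a\<in>ball 0 1 \<Longrightarrow> b\<in>ball 0 1 \<Longrightarrow> dist a b \<le> L * dist (\<Phi> a) (\<Phi> b)"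
       "ball y (1 / (2*L)) \<subseteq> \<Phi> ` ball 0 1"
       "\<And>a. a\<in>ball 0 1 \<Longrightarrow> a $ k < 0 \<Longrightarrow> \<Phi> a \<notin> closure D"
      by (auto simp: half_ball_chart_def)
    \<comment> \<open>With this depth the centre \<open>z\<close> is within
      \<open>L * s = r/4\<close> of \<open>y\<close>. A ball of radius
      \<open>r / (8 * (L * L))\<close> around \<open>z\<close> pulls back to within
      \<open>s/2\<close> of \<open>- s *\<^sub>R e\<close>, hence stays in the lower half; this is
      the origin of the constant \<open>c\<close>.\<close>
    define s where "s = r / (4 * L)"
    have s: "0 < s" "L * s = r / 4" using r L by (simp_all add: s_def)
    have "s \<le> L * s" using s L by simp
    also have "\<dots> < 1"
    proof -
      have "1 / (2*L) \<le> 1/2" using L by (simp add: field_simps)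
      then show ?thesis using s r by linarith
    qed
    finally have "s < 1" .
    then have a: "- s *\<^sub>R e \<in> ball 0 1" using s e by simp
    define z where "z = \<Phi> (- s *\<^sub>R e)"
    have "dist z y \<le> L * dist (- s *\<^sub>R e) 0"
      using lipschitz_onD[OF \<Phi>(2) a, of 0] \<Phi>(1) by (simp add: z_def)
    then have zy: "dist z y \<le> r / 4" using s e by simp
    moreover have "w \<notin> closure D" if w: "w \<in> ball z (1 / (8 * (L * L)) * r)" for w
    proof -
      have "1 / (8 * (L * L)) * r \<le> 1/8 * r"
        using L2 r by (intro mult_right_mono) (auto simp: field_simps)
      then have "dist z w < r / 8" using w by simp
      then have "dist y w < 1 / (2*L)"
        using zy r dist_triangle[of y w z] by (simp add: dist_commute)
      then obtain b where b: "b \<in> ball 0 1" "w = \<Phi> b" using \<Phi>(4) by (auto simp: subset_iff)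
      have "dist b (- s *\<^sub>R e) \<le> L * dist w z" using \<Phi>(3)[OF b(1) a] b by (simp add: z_def)
      also have "\<dots> < L * (1 / (8 * (L * L)) * r)"
        using w L by (intro mult_strict_left_mono) (auto simp: dist_commute)
      also have "\<dots> = s / 2" using L by (simp add: s_def)
      finally have "norm (b + s *\<^sub>R e) < s / 2" by (simp add: dist_norm)
      then have "\<bar>(b + s *\<^sub>R e) $ k\<bar> < s / 2" using component_le_norm_cart le_less_trans by blast
      then have "b $ k < 0" using s e by (simp add: abs_if split: if_splits)
      then show ?thesis using \<Phi>(5) b by blast
    qed
    ultimately show "\<exists>z. dist z y \<le> r/4 \<and> ball z (1 / (8 * (L * L)) * r) \<inter> closure D = {}" by blast
  next
    fix v :: "real ^ 'n \<Rightarrow> real" and x y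
    assume v: "continuous_on UNIV v" "\<And>x. x \<notin> closure D \<Longrightarrow> slope1 v x"
      and y: "y \<in> frontier D" and x: "x \<notin> D" "dist x y < 1 / (2*L)"
    from chart[OF y] obtain \<Phi> where "half_ball_chart k D L y \<Phi>" by blast
    then have \<Phi>: "\<Phi> 0 = y" "L-lipschitz_on (ball 0 1) \<Phi>"
       "\<And>a b. a\<in>ball 0 1 \<Longrightarrow> b\<in>ball 0 1 \<Longrightarrow> dist a b \<le> L * dist (\<Phi> a) (\<Phi> b)"
       "ball y (1 / (2*L)) \<subseteq> \<Phi> ` ball 0 1"
       "\<And>a. a\<in>ball 0 1 \<Longrightarrow> a $ k < 0 \<Longrightarrow> \<Phi> a \<notin> closure D"
       "\<And>a. a\<in>ball 0 1 \<Longrightarrow> 0 < a $ k \<Longrightarrow> \<Phi> a \<in> D"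
      by (auto simp: half_ball_chart_def)
    obtain a where a: "a \<in> ball 0 1" "x = \<Phi> a" using \<Phi>(4) x by (auto simp: dist_commute subset_iff)
    have ak: "a $ k \<le> 0" using \<Phi>(6)[OF a(1)] a x by force
    have na: "norm a \<le> L * dist x y" using \<Phi>(3)[OF a(1), of 0] \<Phi>(1) a by simp
    \<comment> \<open>The segment from 0 to \<open>a\<close> may run in the hyperplane, where no
      slope bound is known. Shifting it down by \<open>s\<close> puts it strictly below; letting
      \<open>s\<close> tend to 0 recovers the endpoints by continuity of \<open>v\<close>.\<close>
    have ineq: "\<bar>v (\<Phi> (a - s *\<^sub>R e)) - v (\<Phi> (0 - s *\<^sub>R e))\<bar> \<le> L * norm a"
      if s: "0 < s" "s < 1 - norm a" for s
    proof -
      have ball: "t *\<^sub>R a - s *\<^sub>R e \<in> ball 0 1" if "t \<in> {0..1}" for t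
      proof -
        have "norm (t *\<^sub>R a - s *\<^sub>R e) \<le> norm (t *\<^sub>R a) + norm (s *\<^sub>R e)" by (rule norm_triangle_ineq4)
        also have "\<dots> \<le> norm a + s" using that s e by (auto intro: mult_left_le_one_le)
        finally show ?thesis using s by simp
      qed
      have "(L * norm a)-lipschitz_on {0..1} (\<lambda>t. \<Phi> (t *\<^sub>R a - s *\<^sub>R e))"
      proof (rule lipschitz_onI)
        fix t t' :: real assume tt: "t \<in> {0..1}" "t' \<in> {0..1}"
        have "dist (\<Phi> (t *\<^sub>R a - s *\<^sub>R e)) (\<Phi> (t' *\<^sub>R a - s *\<^sub>R e))
            \<le> L * dist (t *\<^sub>R a - s *\<^sub>R e) (t' *\<^sub>R a - s *\<^sub>R e)"
          using lipschitz_onD[OF \<Phi>(2)] ball tt by blast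
        also have "dist (t *\<^sub>R a - s *\<^sub>R e) (t' *\<^sub>R a - s *\<^sub>R e) = norm a * dist t t'"
          by (simp add: dist_norm mult.commute flip: scaleR_left_diff_distrib)
        finally show "dist (\<Phi> (t *\<^sub>R a - s *\<^sub>R e)) (\<Phi> (t' *\<^sub>R a - s *\<^sub>R e)) \<le> L * norm a * dist t t'"
          by (simp add: mult.assoc)
      qed (use L in simp)
      moreover have "slope1 v (\<Phi> (t *\<^sub>R a - s *\<^sub>R e))" if t: "t \<in> {0..1}" for t
      proof -
        have "t * a $ k \<le> 0" using t ak by (simp add: mult_nonneg_nonpos)
        then have "(t *\<^sub>R a - s *\<^sub>R e) $ k < 0" using s e by simp
        then show ?thesis using v(2) \<Phi>(5) ball[OF t] by blast
      qed
      ultimately show ?thesis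
        using slope1_along_path[of 0 1 v "\<lambda>t. \<Phi> (t *\<^sub>R a - s *\<^sub>R e)" "L * norm a"] by simp
    qed
    have lim: "((\<lambda>s. v (\<Phi> (p - s *\<^sub>R e))) \<longlongrightarrow> v (\<Phi> p)) (at_right 0)" if p: "p \<in> ball 0 1" for p
    proof -
      have "isCont \<Phi> p"
        using lipschitz_on_continuous_on[OF \<Phi>(2)] p by (simp add: continuous_on_eq_continuous_at)
      moreover have "isCont v (\<Phi> p)" using v(1) by (simp add: continuous_on_eq_continuous_at)
      ultimately have "isCont (\<lambda>q. v (\<Phi> q)) p" by (rule continuous_at_compose[unfolded o_def])
      moreover have "((\<lambda>s. p - s *\<^sub>R e) \<longlongrightarrow> p - 0 *\<^sub>R e) (at_right 0)" by (intro tendsto_intros)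
      ultimately show ?thesis by (auto intro: isCont_tendsto_compose)
    qed
    have "\<bar>v (\<Phi> a) - v (\<Phi> 0)\<bar> \<le> L * norm a"
    proof (rule tendsto_upperbound)
      show "((\<lambda>s. \<bar>v (\<Phi> (a - s *\<^sub>R e)) - v (\<Phi> (0 - s *\<^sub>R e))\<bar>) \<longlongrightarrow> \<bar>v (\<Phi> a) - v (\<Phi> 0)\<bar>) (at_right 0)"
        using a by (intro tendsto_intros lim) auto
      show "\<forall>\<^sub>F s in at_right 0. \<bar>v (\<Phi> (a - s *\<^sub>R e)) - v (\<Phi> (0 - s *\<^sub>R e))\<bar> \<le> L * norm a"
        unfolding eventually_at_right_field using ineq a by (intro exI[of _ "1 - norm a"]) auto
    qed simp
    also have "\<dots> \<le> L * (L * dist x y)" using na L by (intro mult_left_mono) auto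
    finally show "\<bar>v x - v y\<bar> \<le> L * L * dist x y" using \<Phi>(1) a by (simp add: mult.assoc)
  qed (use L L2 in \<open>auto simp: field_simps\<close>)
qed

section \<open>Local comparison, neighbourhoods and a recursion\<close>

lemma C2_on_subset: "C2_on S f \<Longrightarrow> T \<subseteq> S \<Longrightarrow> C2_on T f"
  unfolding C2_on_def by (meson continuous_on_subset differentiable_on_subset)

lemma C2_with_local_compare:
  assumes f: "C2_with S f G H" "open S" and f': "C2_with S' f' G' H'" "open S'"
    and x: "x \<in> S" "x \<in> S'" and le: "\<forall>\<^sub>F y in nhds x. f y \<le> f' y" "f x = f' x"
  shows "trace_op (H x) \<le> trace_op (H' x)" "G' x = G x"
proof -
  have "C2_with (S \<inter> S') (\<lambda>x. f' x + (0 + (- 1) * f x)) (\<lambda>x. G' x + (- 1) *\<^sub>R G x)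
      (\<lambda>x h. H' x h + (- 1) *\<^sub>R H x h)"
    using f f' by (intro C2_with_add C2_with_affine) (auto elim: C2_with_subset)
  note * = C2_with_local_min[OF this, of x]
  have "\<forall>\<^sub>F y in nhds x. f' x + (0 + (- 1) * f x) \<le> f' y + (0 + (- 1) * f y)"
    using le(1) by eventually_elim (use le(2) in simp)
  from *[OF _ _ this] show "trace_op (H x) \<le> trace_op (H' x)" "G' x = G x"
    using f f' x trace_op_add[of "H' x" "\<lambda>h. (- 1) *\<^sub>R H x h"] trace_op_scaleR[of "-1" "H x"]
    by auto
qed

lemma eventually_nhds_ball:
  "x \<in> S \<Longrightarrow> open S \<Longrightarrow> (\<And>y. y \<in> S \<Longrightarrow> P y) \<Longrightarrow> \<forall>\<^sub>F y in nhds x. P y"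
  using eventually_nhds by blast

lemma slope1_max:
  assumes "slope1 f x" "slope1 g x"
  shows "slope1 (\<lambda>y. max (f y) (g y)) x"
  unfolding slope1_def using assms[unfolded slope1_def]
  by eventually_elim linarith

lemma slope1_cong:
  assumes "\<forall>\<^sub>F y in nhds x. f y = g y"
  shows "slope1 f x \<longleftrightarrow> slope1 g x"
proof -
  have "f x = g x" using assms by (rule eventually_nhds_x_imp_x)
  then show ?thesis
    unfolding slope1_def using eventually_cong[OF assms, of "\<lambda>y. \<bar>f y - f x\<bar> \<le> dist y x" "\<lambda>y. \<bar>g y - g x\<bar> \<le> dist y x"]
    by simp
qed

lemma slope1_imp_continuous:
  assumes "slope1 v x"
  shows "isCont v x"
proof -
  have "((\<lambda>y. v y - v x) \<longlongrightarrow> 0) (nhds x)"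
  proof (rule Lim_null_comparison)
    show "\<forall>\<^sub>F y in nhds x. norm (v y - v x) \<le> dist y x" using assms by (simp add: slope1_def)
    show "((\<lambda>y. dist y x) \<longlongrightarrow> 0) (nhds x)"
      using tendsto_dist[OF filterlim_ident tendsto_const, of x x] by simp
  qed
  then have "(v \<longlongrightarrow> v x) (nhds x)" by (simp add: LIM_zero_cancel)
  then show ?thesis by (simp only: isCont_def tendsto_at_iff_tendsto_nhds)
qed

lemma eventually_nhds_less:
  fixes g :: "'a::t2_space \<Rightarrow> real"
  assumes "continuous_on S g" "open S" "x \<in> S"
  shows "g x < m \<Longrightarrow> \<forall>\<^sub>F y in nhds x. g y < m" "m < g x \<Longrightarrow> \<forall>\<^sub>F y in nhds x. m < g y"
proof -
  have "isCont g x" using assms by (simp add: continuous_on_eq_continuous_at)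
  then have "(g \<longlongrightarrow> g x) (nhds x)" by (simp only: isCont_def tendsto_at_iff_tendsto_nhds)
  note order_tendstoD[OF this]
  then show "g x < m \<Longrightarrow> \<forall>\<^sub>F y in nhds x. g y < m" "m < g x \<Longrightarrow> \<forall>\<^sub>F y in nhds x. m < g y"
    by auto
qed

lemma eventually_nhds_cball:
  fixes x :: "'a::metric_space"
  assumes "\<forall>\<^sub>F y in nhds x. Q y"
  obtains s where "0 < s" "\<And>y. y \<in> cball x s \<Longrightarrow> Q y"
proof -
  obtain d where d: "d > 0" "\<And>y. dist y x < d \<Longrightarrow> Q y"
    using assms by (auto simp: eventually_nhds_metric)
  then show thesis using that[of "d/2"] by (auto simp: dist_commute)
qed

lemma geometric_recursion_tendsto_0:
  fixes b :: "nat \<Rightarrow> real"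
  assumes \<theta>: "0 < \<theta>" "\<theta> < 1" and b: "\<And>k. 0 \<le> b k" "\<And>k. b (Suc k) \<le> \<theta> * b k + A / 8 ^ k"
    and A: "0 \<le> A"
  shows "b \<longlonglongrightarrow> 0"
proof -
  \<comment> \<open>A rate between \<open>\<theta>\<close> and 1 that is also at least 1/8, so it
    dominates the source term. \<open>B\<close> is chosen with
    \<open>A \<le> B * (\<tau> - \<theta>)\<close>, and then the induction closes because
    \<open>\<theta> * B + B * (\<tau> - \<theta>) = B * \<tau>\<close>.\<close>
  define \<tau> where "\<tau> = (1 + \<theta>) / 2"
  have \<tau>: "0 < \<tau>" "\<tau> < 1" "\<theta> < \<tau>" "1/8 \<le> \<tau>" using \<theta> by (auto simp: \<tau>_def)
  define B where "B = b 0 + A / (\<tau> - \<theta>)"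
  have B: "b 0 \<le> B" "A \<le> B * (\<tau> - \<theta>)"
    using \<tau> A b(1)[of 0] by (simp_all add: B_def distrib_right)
  have le: "b k \<le> B * \<tau> ^ k" for k
  proof (induction k)
    case (Suc k)
    have "b (Suc k) \<le> \<theta> * b k + A / 8 ^ k" by (rule b)
    also have "\<dots> \<le> \<theta> * (B * \<tau> ^ k) + (B * (\<tau> - \<theta>)) * \<tau> ^ k"
    proof (intro add_mono mult_left_mono Suc.IH)
      have "A / 8 ^ k = A * (1/8) ^ k" by (simp add: power_divide)
      also have "\<dots> \<le> (B * (\<tau> - \<theta>)) * \<tau> ^ k"
        using A B(2) \<tau>(4) by (intro mult_mono power_mono) auto
      finally show "A / 8 ^ k \<le> (B * (\<tau> - \<theta>)) * \<tau> ^ k" .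
    qed (use \<theta> in auto)
    also have "\<dots> = B * \<tau> ^ Suc k" by (simp add: algebra_simps)
    finally show ?case .
  qed (use B in simp)
  have "(\<lambda>k. B * \<tau> ^ k) \<longlonglongrightarrow> B * 0"
    using \<tau> by (intro tendsto_intros LIMSEQ_realpow_zero) auto
  then show ?thesis
    by (intro tendsto_sandwich[OF _ _ tendsto_const, of 0 b sequentially "\<lambda>k. B * \<tau> ^ k"])
      (use b(1) le in auto)
qed

subsection \<open>Subsolutions and boundary oscillation\<close>

text \<open>The charts enter only through the two geometric assumptions, whose constants
  \<open>c\<close>, \<open>r0\<close> and \<open>C\<close> are the same at every boundary
  point.\<close>

locale mixed_problem =
  fixes \<Omega> P :: "(real ^ 'n::finite) set" and c r0 C :: real
  assumes open_\<Omega>: "open \<Omega>" and bounded_\<Omega>: "bounded \<Omega>" and open_P: "open P" and P_sub: "P \<subseteq> \<Omega>"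
    and c: "0 < c" "c \<le> 1/8" and r0: "0 < r0" "r0 \<le> 1" and C_nonneg: "0 \<le> C"
    and corkscrew: "\<And>y r. y \<in> frontier P \<Longrightarrow> 0 < r \<Longrightarrow> r \<le> r0 \<Longrightarrow>
       \<exists>z. dist z y \<le> r/4 \<and> ball z (c * r) \<inter> closure P = {}"
    and exterior_lipschitz: "\<And>v x y. continuous_on UNIV v \<Longrightarrow> (\<And>x. x \<notin> closure P \<Longrightarrow> slope1 v x) \<Longrightarrow>
       y \<in> frontier P \<Longrightarrow> x \<notin> P \<Longrightarrow> dist x y < r0 \<Longrightarrow> \<bar>v x - v y\<bar> \<le> C * dist x y"
begin

definition sub_at :: "(real ^ 'n \<Rightarrow> real) \<Rightarrow> real ^ 'n \<Rightarrow> bool" where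
  "sub_at v x \<longleftrightarrow> (\<forall>r>0. \<forall>\<phi>. C2_on (ball x r) \<phi> \<longrightarrow> (\<forall>y\<in>ball x r. v y \<le> \<phi> y) \<longrightarrow> v x = \<phi> x \<longrightarrow>
     (x \<in> P \<longrightarrow> H_plus \<phi> x \<le> 0) \<and> (x \<in> frontier P \<longrightarrow> min (H_minus \<phi> x) (H_plus \<phi> x) \<le> 0))"

text \<open>Off \<open>closure P\<close> the condition \<open>slope1\<close> stands in for the
  viscosity inequality and supplies the Lipschitz bound at once. It is imposed on all of space,
  hence also across \<open>frontier \<Omega>\<close>, where the functions vanish. Nonnegativity,
  together with the common upper bound, gives the oscillation bound from which the scale iteration
  starts.\<close>

definition subsols :: "(real ^ 'n \<Rightarrow> real) set" where
  "subsols = {v. continuous_on UNIV v \<and> (\<forall>x. 0 \<le> v x) \<and> (\<forall>x. x \<notin> \<Omega> \<longrightarrow> v x = 0) \<and>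
     (\<forall>x. x \<notin> closure P \<longrightarrow> slope1 v x) \<and> (\<forall>x \<in> \<Omega> \<inter> closure P. sub_at v x)}"

text \<open>The pointwise failure of the subsolution test. On \<open>frontier P\<close> the negation
  of \<open>min\<close> being at most 0 makes both inequalities strict.\<close>

definition strict_at :: "(real ^ 'n \<Rightarrow> real) \<Rightarrow> real ^ 'n \<Rightarrow> bool" where
  "strict_at \<phi> x \<longleftrightarrow> (x \<in> P \<longrightarrow> 0 < H_plus \<phi> x) \<and>
     (x \<in> frontier P \<longrightarrow> 0 < H_minus \<phi> x \<and> 0 < H_plus \<phi> x) \<and>
     (x \<notin> closure P \<longrightarrow> 0 < H_minus \<phi> x)"

lemma closure_P_cases:
  obtains "x \<in> P" "x \<in> closure P" "x \<notin> frontier P"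
  | "x \<in> frontier P" "x \<in> closure P" "x \<notin> P" | "x \<notin> closure P" "x \<notin> P" "x \<notin> frontier P"
  using open_P closure_subset[of P] by (fastforce simp: frontier_def interior_open)

lemma subsolsD:
  assumes "v \<in> subsols"
  shows "continuous_on UNIV v" "0 \<le> v x" "x \<notin> \<Omega> \<Longrightarrow> v x = 0"
    "x \<notin> closure P \<Longrightarrow> slope1 v x" "x \<in> \<Omega> \<Longrightarrow> x \<in> closure P \<Longrightarrow> sub_at v x"
  using assms by (auto simp: subsols_def)

lemma subsols_exterior:
  assumes "v \<in> subsols" "y \<in> frontier P" "x \<notin> P" "dist x y < r0"
  shows "\<bar>v x - v y\<bar> \<le> C * dist x y"
  using exterior_lipschitz subsolsD(1,4)[OF assms(1)] assms(2-) by blast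

text \<open>Puts the three regions under one statement: off \<open>closure P\<close> it follows from
  the slope bound, elsewhere from \<open>sub_at\<close>.\<close>

lemma not_strict_at_touching:
  assumes v: "v \<in> subsols" and x: "x \<in> \<Omega>" and r: "0 < r" and \<phi>: "C2_on (ball x r) \<phi>"
    and le: "\<And>y. y \<in> ball x r \<Longrightarrow> v y \<le> \<phi> y" and eq: "v x = \<phi> x"
  shows "\<not> strict_at \<phi> x"
proof (cases rule: closure_P_cases[of x])
  case 3
  obtain H where H: "C2_with (ball x r) \<phi> (grad \<phi>) H" using C2_on_imp_C2_with[OF \<phi>] by auto
  have "\<forall>\<^sub>F y in nhds x. v y \<le> \<phi> y"
    using r le by (intro eventually_nhds_ball[of x "ball x r"]) auto
  then have "norm (grad \<phi> x) \<le> 1"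
    using slope1_touch_above[OF subsolsD(4)[OF v] H, of x] 3 r eq by auto
  then show ?thesis using 3 by (simp add: strict_at_def H_minus_def)
next
  case 1
  then have "H_plus \<phi> x \<le> 0"
    using subsolsD(5)[OF v x] \<phi> r le eq unfolding sub_at_def by blast
  then show ?thesis using 1 by (simp add: strict_at_def)
next
  case 2
  then have "min (H_minus \<phi> x) (H_plus \<phi> x) \<le> 0"
    using subsolsD(5)[OF v x] \<phi> r le eq unfolding sub_at_def by blast
  then show ?thesis using 2 by (auto simp: strict_at_def)
qed

lemma strict_at_C2_with:
  assumes "C2_with S f G H" "open S" "x \<in> S"
  shows "strict_at f x \<longleftrightarrow> (x \<in> closure P \<longrightarrow> trace_op (H x) < - 2) \<and> (x \<notin> P \<longrightarrow> 1 < norm (G x))"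
  unfolding strict_at_def C2_with_H[OF assms]
  by (cases rule: closure_P_cases[of x]) auto

text \<open>At an interior maximum of \<open>v - \<Psi>\<close>, the function \<open>\<Psi>\<close>
  plus a constant touches \<open>v\<close> from above. It is a legitimate test function and still
  strict, since a constant changes no derivative.\<close>

lemma comparison:
  assumes v: "v \<in> subsols" and N: "open N" "N \<subseteq> \<Omega>"
    and \<Psi>: "C2_with N \<Psi> G H" "continuous_on (closure N) \<Psi>"
    and strict: "\<And>x. x \<in> N \<Longrightarrow> strict_at \<Psi> x"
    and bd: "\<And>x. x \<in> frontier N \<Longrightarrow> v x \<le> \<Psi> x"
    and x: "x \<in> N"
  shows "v x \<le> \<Psi> x"
proof (rule ccontr)
  assume neg: "\<not> v x \<le> \<Psi> x"
  have "compact (closure N)"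
    using N bounded_\<Omega> by (auto simp: compact_eq_bounded_closed intro: bounded_subset)
  moreover have "continuous_on (closure N) (\<lambda>x. v x - \<Psi> x)"
    using \<Psi>(2) continuous_on_subset[OF subsolsD(1)[OF v]] by (intro continuous_intros) auto
  moreover have "closure N \<noteq> {}" using x by auto
  ultimately obtain x2 where x2: "x2 \<in> closure N" "\<And>y. y \<in> closure N \<Longrightarrow> v y - \<Psi> y \<le> v x2 - \<Psi> x2"
    using continuous_attains_sup[of "closure N" "\<lambda>x. v x - \<Psi> x"] by auto
  have "v x - \<Psi> x \<le> v x2 - \<Psi> x2" using x2(2) x closure_subset by blast
  then have "x2 \<notin> frontier N" using bd[of x2] neg by auto
  then have x2N: "x2 \<in> N" using x2(1) N(1) by (auto simp: frontier_def interior_open)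
  then obtain r where r: "r > 0" "ball x2 r \<subseteq> N" using N(1) openE by blast
  have C2: "C2_with N (\<lambda>y. (v x2 - \<Psi> x2) + 1 * \<Psi> y) (\<lambda>x. 1 *\<^sub>R G x) (\<lambda>x h. 1 *\<^sub>R H x h)"
    by (rule C2_with_affine[OF \<Psi>(1)])
  have "\<not> strict_at (\<lambda>y. (v x2 - \<Psi> x2) + 1 * \<Psi> y) x2"
  proof (rule not_strict_at_touching[OF v _ r(1)])
    show "x2 \<in> \<Omega>" using x2N N by auto
    show "C2_on (ball x2 r) (\<lambda>y. (v x2 - \<Psi> x2) + 1 * \<Psi> y)"
      using C2_with_imp_C2_on[OF C2 N(1)] r(2) C2_on_subset by blast
    show "v y \<le> v x2 - \<Psi> x2 + 1 * \<Psi> y" if "y \<in> ball x2 r" for y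
    proof -
      have "y \<in> closure N" using that r(2) closure_subset by blast
      then show ?thesis using x2(2)[of y] by simp
    qed
  qed simp
  moreover have "strict_at (\<lambda>y. (v x2 - \<Psi> x2) + 1 * \<Psi> y) x2"
    using strict[OF x2N] unfolding strict_at_C2_with[OF C2 N(1) x2N] strict_at_C2_with[OF \<Psi>(1) N(1) x2N]
    by simp
  ultimately show False by simp
qed

section \<open>Smooth subsolutions, the uniform bound and gluing\<close>

text \<open>The Laplacian condition alone also settles points of \<open>frontier P\<close>, because
  the interface test is a minimum.\<close>

lemma sub_at_C2:
  assumes f: "C2_with S f G H" "open S" "x \<in> S" and H: "- 2 \<le> trace_op (H x)"
  shows "sub_at f x"
  unfolding sub_at_def
proof (intro allI impI)
  fix r :: real and \<phi> assume r: "0 < r" and \<phi>: "C2_on (ball x r) \<phi>" "\<forall>y\<in>ball x r. f y \<le> \<phi> y" "f x = \<phi> x"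
  obtain H' where H': "C2_with (ball x r) \<phi> (grad \<phi>) H'" using C2_on_imp_C2_with[OF \<phi>(1)] by auto
  have "\<forall>\<^sub>F y in nhds x. f y \<le> \<phi> y"
    using r \<phi> by (intro eventually_nhds_ball[of x "ball x r"]) auto
  then have "trace_op (H x) \<le> trace_op (H' x)"
    using C2_with_local_compare(1)[OF f(1,2) H' _ f(3)] r \<phi> by auto
  then have "H_plus \<phi> x \<le> 0" using C2_with_H(2)[OF H' open_ball, of x] r H by simp
  then show "(x \<in> P \<longrightarrow> H_plus \<phi> x \<le> 0) \<and> (x \<in> frontier P \<longrightarrow> min (H_minus \<phi> x) (H_plus \<phi> x) \<le> 0)"
    by auto
qed

lemma zero_subsol: "(\<lambda>x. 0) \<in> subsols"
  unfolding subsols_def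
  using sub_at_C2[OF C2_with_const[of UNIV 0]]
  by (auto simp: slope1_def trace_op_def)

lemma subsols_bounded:
  "\<exists>M\<ge>0. \<forall>v\<in>subsols. \<forall>x. v x \<le> M"
proof -
  obtain B where B: "B > 0" "\<And>x. x \<in> \<Omega> \<Longrightarrow> norm x \<le> B"
    using bounded_\<Omega> bounded_pos by blast
  \<comment> \<open>A pole outside the ball containing \<open>\<Omega>\<close>, in an arbitrary
    coordinate direction. Points of \<open>\<Omega>\<close> are at distance at least 1 from it, so
    the gradient of \<open>\<Psi>\<close> has norm at least 4 and one paraboloid is strict for both
    operators. \<open>A\<close> makes \<open>\<Psi>\<close> nonnegative on
    \<open>frontier \<Omega>\<close>.\<close>
  define z :: "real ^ 'n" where "z = (B + 1) *\<^sub>R axis undefined 1"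
  have z: "norm z = B + 1" using B by (simp add: z_def)
  define A where "A = 2 * (2 * B + 1)^2"
  define \<Psi> where "\<Psi> x = A + (- 2) * ((x - z) \<bullet> (x - z))" for x
  define G where "G x = (- 2) *\<^sub>R 2 *\<^sub>R (x - z)" for x
  define H :: "real ^ 'n \<Rightarrow> real ^ 'n \<Rightarrow> real ^ 'n" where "H x h = (- 2) *\<^sub>R 2 *\<^sub>R h" for x h
  have C2: "C2_with S \<Psi> G H" for S
    unfolding \<Psi>_def[abs_def] G_def[abs_def] H_def[abs_def]
    by (rule C2_with_affine[OF C2_with_square])
  have dist: "1 \<le> norm (x - z)" "norm (x - z) \<le> 2 * B + 1" if "norm x \<le> B" for x
    using norm_triangle_ineq4[of x z] norm_triangle_ineq2[of z x] z that
    by (auto simp: norm_minus_commute)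
  have "v x \<le> A" if v: "v \<in> subsols" for v x
  proof (cases "x \<in> \<Omega>")
    case True
    have "v x \<le> \<Psi> x"
    proof (rule comparison[OF v open_\<Omega> _ C2 _ _ _ True])
      show "continuous_on (closure \<Omega>) \<Psi>" using C2_with_continuous(1)[OF C2] .
      show "strict_at \<Psi> x" if x: "x \<in> \<Omega>" for x
      proof -
        have "trace_op (H x) = - 4 * CARD('n)"
          unfolding H_def[abs_def] trace_op_scaleR trace_op_ident by simp
        moreover have "real CARD('n) \<ge> 1" by (simp add: Suc_leI)
        ultimately have "trace_op (H x) < - 2" by linarith
        moreover have "1 < norm (G x)" using dist[OF B(2)[OF x]] by (simp add: G_def)
        ultimately show ?thesis
          unfolding strict_at_C2_with[OF C2 open_UNIV UNIV_I] by simp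
      qed
      show "v x \<le> \<Psi> x" if x: "x \<in> frontier \<Omega>" for x
      proof -
        have "x \<notin> \<Omega>" using x open_\<Omega> by (simp add: frontier_def interior_open)
        then have "v x = 0" using subsolsD(3)[OF v] by blast
        moreover have "norm x \<le> B"
          using closure_minimal[of \<Omega> "cball 0 B"] B x by (auto simp: frontier_def subset_iff)
        then have "(norm (x - z))^2 \<le> (2 * B + 1)^2" using dist by (intro power_mono) auto
        ultimately show ?thesis by (simp add: \<Psi>_def A_def power2_norm_eq_inner)
      qed
    qed simp
    also have "\<dots> \<le> A" by (simp add: \<Psi>_def)
    finally show ?thesis .
  next
    case False
    then show ?thesis using subsolsD(3)[OF v] by (simp add: A_def)
  qed
  moreover have "0 \<le> A" by (simp add: A_def)
  ultimately show ?thesis by blast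
qed

text \<open>On \<open>closure P\<close> the weak inequality suffices: where \<open>?w\<close> equals
  \<open>v\<close>, a function touching \<open>?w\<close> from above touches \<open>v\<close>;
  elsewhere the point is in the open set \<open>N\<close> and \<open>?w\<close> equals
  \<open>\<beta>\<close> there. Off \<open>closure P\<close> the slope bound is two-sided and that
  of \<open>\<beta>\<close> is known only inside \<open>N\<close>, so strictness on the frontier is
  used to make \<open>?w\<close> agree with \<open>v\<close> nearby.\<close>

lemma glue:
  assumes v: "v \<in> subsols" and N: "open N" "N \<subseteq> \<Omega>" and \<beta>: "continuous_on (closure N) \<beta>"
    and bd: "\<And>x. x \<in> frontier N \<Longrightarrow> \<beta> x \<le> v x"
      "\<And>x. x \<in> frontier N \<Longrightarrow> x \<notin> closure P \<Longrightarrow> \<beta> x < v x"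
    and slope: "\<And>x. x \<in> N \<Longrightarrow> x \<notin> closure P \<Longrightarrow> slope1 \<beta> x"
    and sub: "\<And>x. x \<in> N \<Longrightarrow> x \<in> closure P \<Longrightarrow> sub_at \<beta> x"
  shows "(\<lambda>x. if x \<in> N then max (v x) (\<beta> x) else v x) \<in> subsols" (is "?w \<in> _")
proof -
  have vcont: "continuous_on S v" for S using continuous_on_subset[OF subsolsD(1)[OF v]] by simp
  have fr: "x \<in> frontier N" if "x \<in> closure N" "x \<notin> N" for x
    using that N by (simp add: frontier_def interior_open)
  have "continuous_on (closure N \<union> - N) (\<lambda>x. if x \<in> N then max (v x) (\<beta> x) else v x)"
  proof (rule continuous_on_If)
    show "continuous_on (closure N) (\<lambda>x. max (v x) (\<beta> x))"
      using \<beta> vcont by (intro continuous_intros)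
    show "max (v x) (\<beta> x) = v x" if "x \<in> closure N" "x \<notin> N" for x
      using bd(1)[OF fr[OF that]] by simp
  qed (use N vcont in auto)
  moreover have "closure N \<union> - N = UNIV" using closure_subset[of N] by blast
  ultimately have cont: "continuous_on UNIV ?w" by (simp only:)
  have slope_w: "slope1 ?w x" if x: "x \<notin> closure P" for x
  proof -
    consider "x \<in> N" | "x \<notin> closure N" | "x \<in> frontier N" using fr by blast
    then show ?thesis
    proof cases
      case 1
      then have "slope1 ?w x \<longleftrightarrow> slope1 (\<lambda>x. max (v x) (\<beta> x)) x"
        using N by (intro slope1_cong eventually_nhds_ball[of x N]) auto
      then show ?thesis using slope1_max slope[OF 1 x] subsolsD(4)[OF v x] by blast
    next
      case 2
      then have "slope1 ?w x \<longleftrightarrow> slope1 v x"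
        using closure_subset[of N] by (intro slope1_cong eventually_nhds_ball[of x "- closure N"]) auto
      then show ?thesis using subsolsD(4)[OF v x] by blast
    next
      case 3
      have "continuous_on (closure N) (\<lambda>y. v y - \<beta> y)" using \<beta> vcont by (intro continuous_intros)
      moreover have xc: "x \<in> closure N" using 3 by (simp add: frontier_def)
      ultimately have "((\<lambda>y. v y - \<beta> y) \<longlongrightarrow> v x - \<beta> x) (at x within closure N)"
        by (simp add: continuous_on_def)
      moreover have "0 < v x - \<beta> x" using bd(2)[OF 3 x] by simp
      ultimately have "\<forall>\<^sub>F y in at x within closure N. 0 < v y - \<beta> y" by (rule order_tendstoD)
      then have "\<forall>\<^sub>F y in nhds x. y \<noteq> x \<longrightarrow> y \<in> closure N \<longrightarrow> 0 < v y - \<beta> y"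
        by (simp add: eventually_at_filter)
      then have "\<forall>\<^sub>F y in nhds x. ?w y = v y"
      proof eventually_elim
        case (elim y)
        then show ?case using closure_subset[of N] bd(2)[OF 3 x] by (cases "y = x") auto
      qed
      then have "slope1 ?w x \<longleftrightarrow> slope1 v x" by (rule slope1_cong)
      then show ?thesis using subsolsD(4)[OF v x] by blast
    qed
  qed
  have sub_w: "sub_at ?w x" if x: "x \<in> \<Omega>" "x \<in> closure P" for x
  proof (cases "?w x = v x")
    case True
    have le: "v y \<le> ?w y" for y by simp
    show ?thesis
      using subsolsD(5)[OF v x] True order_trans[OF le] unfolding sub_at_def by metis
  next
    case False
    then have xN: "x \<in> N" and eq: "?w x = \<beta> x" by (auto split: if_splits)
    obtain e where e: "e > 0" "ball x e \<subseteq> N" using N(1) xN openE by blast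
    show ?thesis unfolding sub_at_def
    proof (rule allI, rule impI, rule allI, rule impI, rule impI, rule impI)
      fix r :: real and \<phi> assume r: "0 < r" and \<phi>: "C2_on (ball x r) \<phi>" "\<forall>y\<in>ball x r. ?w y \<le> \<phi> y" "?w x = \<phi> x"
      have "C2_on (ball x (min r e)) \<phi>" using \<phi>(1) by (rule C2_on_subset) auto
      moreover have "\<forall>y\<in>ball x (min r e). \<beta> y \<le> \<phi> y"
      proof
        fix y assume y: "y \<in> ball x (min r e)"
        then have "?w y \<le> \<phi> y" "y \<in> N" using \<phi>(2) e by auto
        then show "\<beta> y \<le> \<phi> y" by simp
      qed
      moreover have "\<beta> x = \<phi> x" using eq \<phi>(3) by simp
      moreover have "0 < min r e" using r e by simp
      ultimately show "(x \<in> P \<longrightarrow> H_plus \<phi> x \<le> 0) \<and> (x \<in> frontier P \<longrightarrow> min (H_minus \<phi> x) (H_plus \<phi> x) \<le> 0)"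
        using sub[OF xN x(2)] unfolding sub_at_def by blast
    qed
  qed
  have "0 \<le> ?w x" for x using subsolsD(2)[OF v, of x] by auto
  moreover have "?w x = 0" if "x \<notin> \<Omega>" for x using subsolsD(3)[OF v that] that N by auto
  ultimately show ?thesis using cont slope_w sub_w unfolding subsols_def by blast
qed

section \<open>Decay of the oscillation at the boundary of \<open>P\<close>\<close>

text \<open>Both halves use a barrier that is 1 on the far part of the boundary of \<open>N\<close>
  and at most \<open>\<theta>\<close> near \<open>y\<close>. The term \<open>C * r\<close> pays for
  the variation of \<open>v\<close> off \<open>P\<close>. The lower half can only be had for a
  larger competitor, as \<open>v\<close> itself may dip inside \<open>P\<close>.\<close>

lemma boundary_step:
  obtains \<theta> K where "0 < \<theta>" "\<theta> < 1" "0 < K"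
    "\<And>v y r M x. v \<in> subsols \<Longrightarrow> y \<in> frontier P \<Longrightarrow> 0 < r \<Longrightarrow> r \<le> r0 \<Longrightarrow> 0 \<le> M \<Longrightarrow>
       (\<And>x. x \<in> ball y r \<Longrightarrow> v x \<le> v y + M) \<Longrightarrow> x \<in> ball y (r/8) \<Longrightarrow>
       v x \<le> v y + (C * r + \<theta> * (M + K * r^2))"
    "\<And>v y r M. v \<in> subsols \<Longrightarrow> y \<in> frontier P \<Longrightarrow> 0 < r \<Longrightarrow> r \<le> r0 \<Longrightarrow> 0 \<le> M \<Longrightarrow>
       (\<And>x. x \<in> ball y r \<Longrightarrow> v y - M \<le> v x) \<Longrightarrow>
       \<exists>w\<in>subsols. (\<forall>x. v x \<le> w x) \<and> (\<forall>x. x \<notin> P \<longrightarrow> w x = v x) \<and>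
         (\<forall>x\<in>ball y (r/8). v y - (C * r + \<theta> * (M + K * r^2)) \<le> w x)"
proof -
  obtain \<theta> K where \<theta>K: "0 < \<theta>" "\<theta> < 1" "0 < K" and barrier:
    "\<And>(z :: real ^ 'n::finite) r. 0 < r \<Longrightarrow> \<exists>\<psi> G H. C2_with UNIV \<psi> G H \<and>
       (\<forall>x. c * r \<le> dist x z \<longrightarrow> 0 \<le> \<psi> x) \<and>
       (\<forall>x. dist x z = r/2 \<longrightarrow> \<psi> x = 1) \<and>
       (\<forall>x. dist x z \<le> 3*r/8 \<longrightarrow> \<psi> x \<le> \<theta>) \<and>
       (\<forall>x. c * r \<le> dist x z \<and> dist x z \<le> r/2 \<longrightarrow> K * r^2 * trace_op (H x) < -2)"
    using annulus_barrier[OF c] by blast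
  \<comment> \<open>\<open>N\<close> is cut out by a ball around the exterior centre
    \<open>z\<close>, not around \<open>y\<close>. The radii fit because
    \<open>r/8 + r/4 < r/2\<close> and \<open>r/2 + r/4 < r\<close>. A frontier point of
    \<open>N\<close> is either off \<open>P\<close>, where the exterior estimate applies, or on the
    sphere of radius \<open>r/2\<close>, where \<open>\<psi>\<close> is 1.\<close>
  have region: "\<exists>\<psi> G H N. C2_with UNIV \<psi> G H \<and> open N \<and> N \<subseteq> P \<and> N \<subseteq> ball y r \<and>
      P \<inter> ball y (r/8) \<subseteq> N \<and>
      (\<forall>x\<in>closure N. 0 \<le> \<psi> x) \<and> (\<forall>x\<in>frontier N. x \<in> ball y r \<and> (x \<notin> P \<or> \<psi> x = 1)) \<and>
      (\<forall>x\<in>N \<inter> ball y (r/8). \<psi> x \<le> \<theta>) \<and> (\<forall>x\<in>N. K * r^2 * trace_op (H x) < -2)"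
    if y: "y \<in> frontier P" and r: "0 < r" "r \<le> r0" for y r
  proof -
    obtain z where z: "dist z y \<le> r/4" "ball z (c * r) \<inter> closure P = {}"
      using corkscrew[OF y r] by blast
    obtain \<psi> G H where \<psi>: "C2_with UNIV \<psi> G H" "\<And>x. c * r \<le> dist x z \<Longrightarrow> 0 \<le> \<psi> x"
      "\<And>x. dist x z = r/2 \<Longrightarrow> \<psi> x = 1" "\<And>x. dist x z \<le> 3*r/8 \<Longrightarrow> \<psi> x \<le> \<theta>"
      "\<And>x. c * r \<le> dist x z \<Longrightarrow> dist x z \<le> r/2 \<Longrightarrow> K * r^2 * trace_op (H x) < -2"
      using barrier[OF r(1), of z] by blast
    define N where "N = ball z (r/2) \<inter> P"
    have N: "open N" "N \<subseteq> P" using open_P by (auto simp: N_def)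
    have far: "c * r \<le> dist x z" if "x \<in> closure P" for x
      using z(2) that by (force simp: dist_commute not_le)
    have near: "dist x y \<le> dist x z + r/4" for x using z(1) dist_triangle[of x y z] by linarith
    have near': "dist x z \<le> dist x y + r/4" for x
      using z(1) dist_triangle[of x z y] by (simp add: dist_commute)
    have clN: "closure N \<subseteq> cball z (r/2)" "closure N \<subseteq> closure P"
      unfolding N_def by (auto intro: closure_mono[THEN subsetD] closure_minimal[THEN subsetD, rotated 2])
    have "x \<in> ball y r" if "x \<in> N" for x
      using near[of x] r that by (simp add: N_def dist_commute)
    then have n1: "N \<subseteq> ball y r" by blast
    have "x \<in> N" if "x \<in> P \<inter> ball y (r/8)" for x
      using near'[of x] r that by (simp add: N_def dist_commute)
    then have n2: "P \<inter> ball y (r/8) \<subseteq> N" by blast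
    have n3: "0 \<le> \<psi> x" if "x \<in> closure N" for x using that clN far \<psi>(2) by blast
    have n4: "x \<in> ball y r \<and> (x \<notin> P \<or> \<psi> x = 1)" if x: "x \<in> frontier N" for x
    proof -
      have xc: "x \<in> closure N" "x \<notin> N" using x N by (auto simp: frontier_def interior_open)
      then have d: "dist x z \<le> r/2" using clN by (auto simp: dist_commute)
      then have "x \<in> ball y r" using near[of x] r by (simp add: dist_commute)
      moreover have "\<psi> x = 1" if "x \<in> P"
        using xc that d by (intro \<psi>(3)) (auto simp: N_def dist_commute)
      ultimately show ?thesis by blast
    qed
    have n5: "\<psi> x \<le> \<theta>" if "x \<in> N \<inter> ball y (r/8)" for x
      using that near'[of x] by (intro \<psi>(4)) (auto simp: dist_commute)
    have n6: "K * r^2 * trace_op (H x) < -2" if "x \<in> N" for x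
      using that far closure_subset[of P] by (intro \<psi>(5)) (auto simp: N_def dist_commute)
    show ?thesis
      by (intro exI[of _ \<psi>] exI[of _ G] exI[of _ H] exI[of _ N] conjI[OF \<psi>(1)] conjI[OF N(1)]
          conjI[OF N(2)] conjI[OF n1] conjI[OF n2] conjI ballI) (erule n3 n4[THEN conjunct1] n4[THEN conjunct2] n5 n6)+
  qed
  have ext: "\<bar>v x - v y\<bar> \<le> C * r"
    if "v \<in> subsols" "y \<in> frontier P" "r \<le> r0" "x \<notin> P" "x \<in> ball y r" for v y r x
  proof -
    have d: "dist x y < r" using that by (simp add: dist_commute)
    then have "\<bar>v x - v y\<bar> \<le> C * dist x y" using that by (intro subsols_exterior) auto
    also have "\<dots> \<le> C * r" using d C_nonneg by (intro mult_left_mono) auto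
    finally show ?thesis .
  qed
  have trace: "M' * t < - 2" if "K * r^2 * t < - 2" "K * r^2 \<le> M'" for M' t r
  proof -
    have "t < 0" using that(1) \<theta>K(3) by (smt (verit) mult_nonneg_nonneg zero_le_power2)
    then have "M' * t \<le> K * r^2 * t" using that(2) by (intro mult_right_mono_neg) auto
    then show ?thesis using that(1) by simp
  qed
  show thesis
  proof (rule that[OF \<theta>K])
    fix v y r M x
    assume v: "v \<in> subsols" and y: "y \<in> frontier P" and r: "0 < r" "r \<le> r0" and M: "0 \<le> M"
      and le: "\<And>x. x \<in> ball y r \<Longrightarrow> v x \<le> v y + M" and x: "x \<in> ball y (r/8)"
    \<comment> \<open>\<open>M\<close> covers the oscillation on the part of
      \<open>frontier N\<close> inside \<open>P\<close>; \<open>K * r^2\<close> brings the Laplacian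
      of the scaled barrier below -2.\<close>
    define M' where "M' = M + K * r^2"
    have M': "0 \<le> M'" "M \<le> M'" "K * r^2 \<le> M'" using M \<theta>K by (auto simp: M'_def)
    have Cr: "0 \<le> C * r" using C_nonneg r by simp
    show "v x \<le> v y + (C * r + \<theta> * (M + K * r^2))"
    proof (cases "x \<in> P")
      case False
      then have "\<bar>v x - v y\<bar> \<le> C * r" using ext[OF v y r(2)] x r by auto
      moreover have "0 \<le> \<theta> * (M + K * r^2)" using \<theta>K M' by (simp add: M'_def)
      ultimately show ?thesis by linarith
    next
      case True
      obtain \<psi> G H N where \<psi>: "C2_with UNIV \<psi> G H" and N: "open N" "N \<subseteq> P" "N \<subseteq> ball y r"
        "P \<inter> ball y (r/8) \<subseteq> N"
        and \<psi>': "\<And>x. x\<in>closure N \<Longrightarrow> 0 \<le> \<psi> x" "\<And>x. x\<in>frontier N \<Longrightarrow> x \<in> ball y r \<and> (x \<notin> P \<or> \<psi> x = 1)"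
        "\<And>x. x\<in>N \<inter> ball y (r/8) \<Longrightarrow> \<psi> x \<le> \<theta>" "\<And>x. x\<in>N \<Longrightarrow> K * r^2 * trace_op (H x) < -2"
        using region[OF y r] by metis
      have C2: "C2_with UNIV (\<lambda>x. (v y + C * r) + M' * \<psi> x) (\<lambda>x. M' *\<^sub>R G x) (\<lambda>x h. M' *\<^sub>R H x h)"
        by (rule C2_with_affine[OF \<psi>])
      have xN: "x \<in> N" using True x N by blast
      have "v x \<le> (v y + C * r) + M' * \<psi> x"
      proof (rule comparison[OF v N(1) _ C2_with_subset[OF C2 subset_UNIV] _ _ _ xN])
        show "N \<subseteq> \<Omega>" using N P_sub by blast
        show "continuous_on (closure N) (\<lambda>x. (v y + C * r) + M' * \<psi> x)"
          using C2_with_continuous(1)[OF C2] continuous_on_subset by blast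
        show "strict_at (\<lambda>x. (v y + C * r) + M' * \<psi> x) x" if "x \<in> N" for x
          using that N trace[OF \<psi>'(4) M'(3), of x]
          unfolding strict_at_C2_with[OF C2 open_UNIV UNIV_I] trace_op_scaleR by auto
        show "v x \<le> (v y + C * r) + M' * \<psi> x" if fx: "x \<in> frontier N" for x
        proof (cases "x \<in> P")
          case True
          then show ?thesis using \<psi>'(2)[OF fx] le[of x] M' Cr by auto
        next
          case False
          then have "\<bar>v x - v y\<bar> \<le> C * r" using \<psi>'(2)[OF fx] ext[OF v y r(2)] by auto
          moreover have "0 \<le> M' * \<psi> x" using \<psi>'(1)[of x] fx M' by (simp add: frontier_def)
          ultimately show ?thesis by linarith
        qed
      qed
      also have "M' * \<psi> x \<le> M' * \<theta>" using \<psi>'(3) xN x M' by (intro mult_left_mono) auto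
      finally show ?thesis by (simp add: M'_def mult.commute)
    qed
  next
    fix v y r M
    assume v: "v \<in> subsols" and y: "y \<in> frontier P" and r: "0 < r" "r \<le> r0" and M: "0 \<le> M"
      and ge: "\<And>x. x \<in> ball y r \<Longrightarrow> v y - M \<le> v x"
    define M' where "M' = M + K * r^2"
    have M': "0 \<le> M'" "M \<le> M'" "K * r^2 \<le> M'" using M \<theta>K by (auto simp: M'_def)
    have Cr: "0 \<le> C * r" using C_nonneg r by simp
    obtain \<psi> G H N where \<psi>: "C2_with UNIV \<psi> G H" and N: "open N" "N \<subseteq> P" "N \<subseteq> ball y r"
      "P \<inter> ball y (r/8) \<subseteq> N"
      and \<psi>': "\<And>x. x\<in>closure N \<Longrightarrow> 0 \<le> \<psi> x" "\<And>x. x\<in>frontier N \<Longrightarrow> x \<in> ball y r \<and> (x \<notin> P \<or> \<psi> x = 1)"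
      "\<And>x. x\<in>N \<inter> ball y (r/8) \<Longrightarrow> \<psi> x \<le> \<theta>" "\<And>x. x\<in>N \<Longrightarrow> K * r^2 * trace_op (H x) < -2"
      using region[OF y r] by metis
    \<comment> \<open>The upper barrier reflected. Its Laplacian is positive on \<open>N\<close>, so
      it is a subsolution there.\<close>
    let ?\<beta> = "\<lambda>x. (v y - C * r) + (- M') * \<psi> x"
    have C2: "C2_with UNIV ?\<beta> (\<lambda>x. (- M') *\<^sub>R G x) (\<lambda>x h. (- M') *\<^sub>R H x h)"
      by (rule C2_with_affine[OF \<psi>])
    let ?w = "\<lambda>x. if x \<in> N then max (v x) (?\<beta> x) else v x"
    have bd: "?\<beta> x \<le> v x" if fx: "x \<in> frontier N" for x
    proof (cases "x \<in> P")
      case True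
      then show ?thesis using \<psi>'(2)[OF fx] ge[of x] M' Cr by auto
    next
      case False
      then have "\<bar>v x - v y\<bar> \<le> C * r" using \<psi>'(2)[OF fx] ext[OF v y r(2)] by auto
      moreover have "0 \<le> M' * \<psi> x" using \<psi>'(1)[of x] fx M' by (simp add: frontier_def)
      ultimately show ?thesis by simp
    qed
    \<comment> \<open>This makes the strict frontier inequality of \<open>glue\<close>
      vacuous.\<close>
    have fr: "frontier N \<subseteq> closure P" using N(2) closure_mono by (auto simp: frontier_def)
    have w1: "?w \<in> subsols"
    proof (rule glue[OF v N(1)])
      show "N \<subseteq> \<Omega>" using N P_sub by blast
      show "continuous_on (closure N) ?\<beta>"
        using C2_with_continuous(1)[OF C2] continuous_on_subset by blast
      show "sub_at ?\<beta> x" if "x \<in> N" for x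
      proof (rule sub_at_C2[OF C2 open_UNIV UNIV_I])
        show "- 2 \<le> trace_op (\<lambda>h. (- M') *\<^sub>R H x h)"
          unfolding trace_op_scaleR using trace[OF \<psi>'(4)[OF that] M'(3)] by simp
      qed
    qed (use bd fr N(2) closure_subset[of P] in auto)
    have w2: "v y - (C * r + \<theta> * (M + K * r^2)) \<le> ?w x" if x: "x \<in> ball y (r/8)" for x
    proof (cases "x \<in> P")
      case False
      then have "\<bar>v x - v y\<bar> \<le> C * r" using ext[OF v y r(2)] x r by auto
      moreover have "0 \<le> \<theta> * (M + K * r^2)" using \<theta>K M' by (simp add: M'_def)
      ultimately have "v y - (C * r + \<theta> * (M + K * r^2)) \<le> v x" by linarith
      then show ?thesis by auto
    next
      case True
      then have xN: "x \<in> N" using x N by blast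
      have "M' * \<psi> x \<le> M' * \<theta>" using \<psi>'(3) xN x M' by (intro mult_left_mono) auto
      then have "v y - (C * r + \<theta> * (M + K * r^2)) \<le> ?\<beta> x"
        by (simp add: M'_def[symmetric] mult.commute)
      then show ?thesis using xN by auto
    qed
    have w3: "\<forall>x. x \<notin> P \<longrightarrow> ?w x = v x" using N(2) by auto
    have w4: "\<forall>x. v x \<le> ?w x" by simp
    show "\<exists>w\<in>subsols. (\<forall>x. v x \<le> w x) \<and> (\<forall>x. x \<notin> P \<longrightarrow> w x = v x) \<and>
         (\<forall>x\<in>ball y (r/8). v y - (C * r + \<theta> * (M + K * r^2)) \<le> w x)"
      by (intro bexI[of _ ?w] conjI ballI) (rule w4 w3 w1 | erule w2)+
  qed
qed

text \<open>\<open>boundary_step\<close> iterated over the scales \<open>r0 / 8 ^ k\<close>. The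
  point is that \<open>b\<close> and \<open>\<rho>\<close> serve all competitors and all boundary
  points at once.\<close>

lemma boundary_modulus:
  obtains b \<rho> :: "nat \<Rightarrow> real" where "b \<longlonglongrightarrow> 0" "\<And>k. 0 \<le> b k" "\<And>k. 0 < \<rho> k"
    "\<And>k v y x. v \<in> subsols \<Longrightarrow> y \<in> frontier P \<Longrightarrow> x \<in> ball y (\<rho> k) \<Longrightarrow> v x \<le> v y + b k"
    "\<And>k v y. v \<in> subsols \<Longrightarrow> y \<in> frontier P \<Longrightarrow>
       \<exists>w\<in>subsols. (\<forall>x. v x \<le> w x) \<and> (\<forall>x. x \<notin> P \<longrightarrow> w x = v x) \<and>
         (\<forall>x\<in>ball y (\<rho> k). v y - b k \<le> w x)"
proof -
  obtain \<theta> K where \<theta>K: "0 < \<theta>" "\<theta> < 1" "0 < K"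
    and up: "\<And>v y r M x. v \<in> subsols \<Longrightarrow> y \<in> frontier P \<Longrightarrow> 0 < r \<Longrightarrow> r \<le> r0 \<Longrightarrow> 0 \<le> M \<Longrightarrow>
       (\<And>x. x \<in> ball y r \<Longrightarrow> v x \<le> v y + M) \<Longrightarrow> x \<in> ball y (r/8) \<Longrightarrow>
       v x \<le> v y + (C * r + \<theta> * (M + K * r^2))"
    and lift: "\<And>v y r M. v \<in> subsols \<Longrightarrow> y \<in> frontier P \<Longrightarrow> 0 < r \<Longrightarrow> r \<le> r0 \<Longrightarrow> 0 \<le> M \<Longrightarrow>
       (\<And>x. x \<in> ball y r \<Longrightarrow> v y - M \<le> v x) \<Longrightarrow>
       \<exists>w\<in>subsols. (\<forall>x. v x \<le> w x) \<and> (\<forall>x. x \<notin> P \<longrightarrow> w x = v x) \<and>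
         (\<forall>x\<in>ball y (r/8). v y - (C * r + \<theta> * (M + K * r^2)) \<le> w x)"
    using boundary_step by blast
  obtain M0 where M0': "0 \<le> M0" "\<forall>v\<in>subsols. \<forall>x. v x \<le> M0"
    using subsols_bounded by blast
  then have M0: "0 \<le> M0" "\<And>v x. v \<in> subsols \<Longrightarrow> v x \<le> M0" by auto
  define \<rho> where "\<rho> k = r0 / 8 ^ k" for k :: nat
  have \<rho>: "0 < \<rho> k" "\<rho> k \<le> r0" "\<rho> (Suc k) = \<rho> k / 8" for k
    using r0 by (auto simp: \<rho>_def field_simps)
  define b where "b = rec_nat M0 (\<lambda>k m. C * \<rho> k + \<theta> * (m + K * (\<rho> k)^2))"
  have b_simps: "b 0 = M0" "b (Suc k) = C * \<rho> k + \<theta> * (b k + K * (\<rho> k)^2)" for k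
    by (simp_all add: b_def)
  have b_nonneg: "0 \<le> b k" for k
    by (induction k) (use M0 C_nonneg \<theta>K \<rho>(1) in \<open>auto simp: b_simps less_imp_le\<close>)
  show thesis
  proof (rule that[of b \<rho>])
    show "b \<longlonglongrightarrow> 0"
    proof (rule geometric_recursion_tendsto_0[OF \<theta>K(1,2) b_nonneg])
      fix k
      \<comment> \<open>With \<open>r0 \<le> 1\<close> the quadratic error decays at least like the
        Lipschitz one, so both fit into one source term of rate 1/8.\<close>
      have "(\<rho> k)^2 \<le> \<rho> k" using \<rho>[of k] r0 by (simp add: power2_eq_square mult_left_le)
      then have "K * (\<rho> k)^2 \<le> K * \<rho> k" using \<theta>K by (intro mult_left_mono) auto
      moreover have "\<theta> * (K * (\<rho> k)^2) \<le> 1 * (K * (\<rho> k)^2)" using \<theta>K by (intro mult_right_mono) auto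
      ultimately show "b (Suc k) \<le> \<theta> * b k + (C + K) * r0 / 8 ^ k"
        by (simp add: b_simps \<rho>_def algebra_simps add_divide_distrib)
    qed (use C_nonneg \<theta>K r0 in auto)
    show "v x \<le> v y + b k" if v: "v \<in> subsols" and y: "y \<in> frontier P" and x: "x \<in> ball y (\<rho> k)" for k v y x
      using x
    proof (induction k arbitrary: x)
      case 0
      then show ?case using M0(2)[OF v, of x] subsolsD(2)[OF v, of y] by (simp add: b_simps)
    next
      case (Suc k)
      then show ?case
        using up[OF v y \<rho>(1,2) b_nonneg Suc.IH, where x = x] by (simp add: b_simps \<rho>(3))
    qed
    show "\<exists>w\<in>subsols. (\<forall>x. v x \<le> w x) \<and> (\<forall>x. x \<notin> P \<longrightarrow> w x = v x) \<and>
         (\<forall>x\<in>ball y (\<rho> k). v y - b k \<le> w x)" if v: "v \<in> subsols" and y: "y \<in> frontier P" for k v y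
    proof (induction k)
      case 0
      have "v y - M0 \<le> v x" for x using M0(2)[OF v, of y] subsolsD(2)[OF v, of x] by linarith
      then show ?case using v by (auto simp: b_simps)
    next
      case (Suc k)
      then obtain w where w: "w \<in> subsols" "\<And>x. v x \<le> w x" "\<And>x. x \<notin> P \<Longrightarrow> w x = v x"
        "\<And>x. x \<in> ball y (\<rho> k) \<Longrightarrow> v y - b k \<le> w x" by blast
      \<comment> \<open>The previous lift kept the value at \<open>y\<close>, so the next step is
        again centred at the number \<open>v y\<close>.\<close>
      have "y \<notin> P" using y open_P by (simp add: frontier_def interior_open)
      then have wy: "w y = v y" by (rule w(3))
      have "\<And>x. x \<in> ball y (\<rho> k) \<Longrightarrow> w y - b k \<le> w x" using w(4) wy by simp
      from lift[OF w(1) y \<rho>(1,2) b_nonneg this]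
      obtain w' where w': "w' \<in> subsols" "\<And>x. w x \<le> w' x" "\<And>x. x \<notin> P \<Longrightarrow> w' x = w x"
        "\<And>x. x \<in> ball y (\<rho> k / 8) \<Longrightarrow> w y - (C * \<rho> k + \<theta> * (b k + K * (\<rho> k)^2)) \<le> w' x"
        by blast
      have "v x \<le> w' x" for x using w(2) w'(2) order_trans by blast
      moreover have "w' x = v x" if "x \<notin> P" for x using w(3) w'(3) that by simp
      moreover have "v y - b (Suc k) \<le> w' x" if "x \<in> ball y (\<rho> (Suc k))" for x
        using w'(4)[of x] that by (simp add: b_simps \<rho>(3) wy)
      ultimately show ?case using w'(1) by blast
    qed
  qed (use b_nonneg \<rho> in auto)
qed

subsection \<open>The Perron solution\<close>

definition perron :: "real ^ 'n \<Rightarrow> real" where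
  "perron x = (SUP v\<in>subsols. v x)"

lemma perron_upper: "v \<in> subsols \<Longrightarrow> v x \<le> perron x"
proof -
  obtain M where M: "\<forall>v\<in>subsols. \<forall>x. v x \<le> M" using subsols_bounded by blast
  have "bdd_above ((\<lambda>v. v x) ` subsols)" using M by (intro bdd_aboveI2) blast
  then show "v \<in> subsols \<Longrightarrow> v x \<le> perron x" unfolding perron_def by (intro cSUP_upper)
qed

lemma perron_least: "(\<And>v. v \<in> subsols \<Longrightarrow> v x \<le> m) \<Longrightarrow> perron x \<le> m"
  unfolding perron_def using zero_subsol by (intro cSUP_least) auto

lemma perron_nonneg: "0 \<le> perron x"
  using perron_upper[OF zero_subsol] .

lemma perron_outside: "x \<notin> \<Omega> \<Longrightarrow> perron x = 0"
  using perron_least[of x 0] perron_nonneg[of x] subsolsD(3) by fastforce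

text \<open>On a ball off \<open>closure P\<close> every competitor is 1-Lipschitz. The radius
  depends only on \<open>x\<close>, so the supremum inherits the bound.\<close>

lemma perron_slope1:
  assumes x: "x \<notin> closure P"
  shows "slope1 perron x"
proof -
  obtain e where e: "e > 0" "ball x e \<subseteq> - closure P"
    using openE[of "- closure P" x] x by auto
  have "\<bar>perron y - perron x\<bar> \<le> dist y x" if y: "y \<in> ball x e" for y
  proof -
    have lip: "\<bar>v y - v x\<bar> \<le> dist y x" if "v \<in> subsols" for v
      using e y subsolsD(4)[OF that] by (intro slope1_convex[of "ball x e"]) auto
    have "v y \<le> perron x + dist y x" "v x \<le> perron y + dist y x" if "v \<in> subsols" for v
      using lip[OF that] perron_upper[OF that, of x] perron_upper[OF that, of y] by linarith+
    then have "perron y \<le> perron x + dist y x" "perron x \<le> perron y + dist y x"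
      by (auto intro: perron_least)
    then show ?thesis by linarith
  qed
  then show ?thesis
    unfolding slope1_def using e(1) by (intro eventually_nhds_ball[of x "ball x e"]) auto
qed

section \<open>Continuity of the supremum\<close>

text \<open>With \<open>x\<close> and \<open>x + h\<close> both in \<open>P\<close> only the Poisson
  test is active at either point, and it is invariant under translations and added
  constants.\<close>

lemma sub_at_shift:
  assumes v: "sub_at v (x + h)" and x: "x \<in> P" "x + h \<in> P"
  shows "sub_at (\<lambda>y. v (y + h) - m) x"
  unfolding sub_at_def
proof (intro allI impI)
  fix r :: real and \<phi> assume r: "0 < r" and \<phi>: "C2_on (ball x r) \<phi>"
    and le: "\<forall>y\<in>ball x r. v (y + h) - m \<le> \<phi> y" and eq: "v (x + h) - m = \<phi> x"
  obtain H where H: "C2_with (ball x r) \<phi> (grad \<phi>) H" using C2_on_imp_C2_with[OF \<phi>] by auto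
  have vimage: "(\<lambda>y. y + - h) -` ball x r = ball (x + h) r"
    by (auto simp: dist_norm algebra_simps)
  have C2: "C2_with (ball (x + h) r) (\<lambda>y. m + 1 * \<phi> (y + - h)) (\<lambda>y. 1 *\<^sub>R grad \<phi> (y + - h))
      (\<lambda>y k. 1 *\<^sub>R H (y + - h) k)"
    using C2_with_affine[OF C2_with_shift[OF H, of "- h"], of m 1] unfolding vimage .
  have "v y \<le> m + 1 * \<phi> (y + - h)" if "y \<in> ball (x + h) r" for y
    using bspec[OF le, of "y - h"] that by (simp add: dist_norm algebra_simps)
  moreover have "v (x + h) = m + 1 * \<phi> (x + h + - h)" using eq by simp
  ultimately have "H_plus (\<lambda>y. m + 1 * \<phi> (y + - h)) (x + h) \<le> 0"
    using v[unfolded sub_at_def] r C2_with_imp_C2_on[OF C2 open_ball] x(2) by blast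
  then have "H_plus \<phi> x \<le> 0"
    using C2_with_H(2)[OF C2 open_ball, of "x + h"] C2_with_H(2)[OF H open_ball, of x] r by simp
  then show "(x \<in> P \<longrightarrow> H_plus \<phi> x \<le> 0) \<and> (x \<in> frontier P \<longrightarrow> min (H_minus \<phi> x) (H_plus \<phi> x) \<le> 0)"
    by auto
qed

lemma bounded_P: "bounded P"
  using bounded_\<Omega> P_sub bounded_subset by blast

lemma perron_continuous: "isCont perron x"
proof -
  obtain b \<rho> :: "nat \<Rightarrow> real" where b: "b \<longlonglongrightarrow> 0" "\<And>k. 0 \<le> b k" and \<rho>: "\<And>k. 0 < \<rho> k"
    and up: "\<And>k v y x. v \<in> subsols \<Longrightarrow> y \<in> frontier P \<Longrightarrow> x \<in> ball y (\<rho> k) \<Longrightarrow> v x \<le> v y + b k"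
    and lift: "\<And>k v y. v \<in> subsols \<Longrightarrow> y \<in> frontier P \<Longrightarrow>
       \<exists>w\<in>subsols. (\<forall>x. v x \<le> w x) \<and> (\<forall>x. x \<notin> P \<longrightarrow> w x = v x) \<and>
         (\<forall>x\<in>ball y (\<rho> k). v y - b k \<le> w x)"
    using boundary_modulus by blast
  have b_small: "\<exists>k. 2 * b k < e" if "e > 0" for e
  proof -
    have "\<forall>\<^sub>F k in sequentially. b k < e / 2" using b(1) that by (intro order_tendstoD) auto
    then obtain k where "b k < e / 2" by (auto simp: eventually_sequentially)
    then show ?thesis by (intro exI[of _ k]) simp
  qed
  \<comment> \<open>Successive lifts do not interfere: each one only raises the function and keeps
    it off \<open>P\<close>, so the values \<open>v y\<close> at the other centres survive.\<close>
  have lift_finite: "\<exists>w\<in>subsols. (\<forall>x. v x \<le> w x) \<and> (\<forall>x. x \<notin> P \<longrightarrow> w x = v x) \<and>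
         (\<forall>y\<in>Y. \<forall>x\<in>ball y (\<rho> k). v y - b k \<le> w x)"
    if v: "v \<in> subsols" and Y: "finite Y" "Y \<subseteq> frontier P" for v Y k
    using Y
  proof (induction Y rule: finite_induct)
    case empty
    then show ?case using v by auto
  next
    case (insert y Y)
    then obtain w where w: "w \<in> subsols" "\<And>x. v x \<le> w x" "\<And>x. x \<notin> P \<Longrightarrow> w x = v x"
      "\<And>y x. y \<in> Y \<Longrightarrow> x \<in> ball y (\<rho> k) \<Longrightarrow> v y - b k \<le> w x" by blast
    have y: "y \<in> frontier P" "y \<notin> P"
      using insert.prems open_P by (auto simp: frontier_def interior_open)
    obtain w' where w': "w' \<in> subsols" "\<And>x. w x \<le> w' x" "\<And>x. x \<notin> P \<Longrightarrow> w' x = w x"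
        "\<And>x. x \<in> ball y (\<rho> k) \<Longrightarrow> w y - b k \<le> w' x"
      using lift[OF w(1) y(1), of k] by blast
    have "v x \<le> w' x" for x using w(2) w'(2) order_trans by blast
    moreover have "w' x = v x" if "x \<notin> P" for x using w(3) w'(3) that by simp
    moreover have "v y' - b k \<le> w' x" if "y' \<in> insert y Y" "x \<in> ball y' (\<rho> k)" for y' x
    proof (cases "y' = y")
      case True
      then show ?thesis using w'(4)[of x] that w(3)[OF y(2)] by simp
    next
      case False
      then have "v y' - b k \<le> w x" using w(4) that by auto
      then show ?thesis using w'(2)[of x] by linarith
    qed
    ultimately show ?case using w'(1) by blast
  qed
  have translate: "perron (x + h) \<le> perron x + 2 * b k"
    if x: "x \<in> P" "x + h \<in> P" and h: "norm h < \<rho> k / 2" for x h k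
  proof (rule perron_least)
    fix v assume v: "v \<in> subsols"
    \<comment> \<open>The cover uses half radii so that a boundary point, moved by \<open>h\<close>,
      still lies in the full ball where the lift is controlled.\<close>
    have "compact (frontier P)" using bounded_P by (rule compact_frontier_bounded)
    then obtain Y where Y: "finite Y" "Y \<subseteq> frontier P" "frontier P \<subseteq> (\<Union>y\<in>Y. ball y (\<rho> k / 2))"
    proof (rule compactE_image)
      show "frontier P \<subseteq> (\<Union>y\<in>frontier P. ball y (\<rho> k / 2))" using \<rho>[of k] by force
    qed auto
    obtain w where w: "w \<in> subsols" "\<And>x. v x \<le> w x" "\<And>x. x \<notin> P \<Longrightarrow> w x = v x"
      "\<And>y x. y \<in> Y \<Longrightarrow> x \<in> ball y (\<rho> k) \<Longrightarrow> v y - b k \<le> w x"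
      using lift_finite[OF v Y(1,2), of k] by blast
    define N where "N = P \<inter> (\<lambda>x. x + h) -` P"
    have N: "open N" "N \<subseteq> P" "N \<subseteq> \<Omega>"
      using open_P P_sub unfolding N_def by (auto intro!: open_Int open_vimage continuous_intros)
    let ?\<beta> = "\<lambda>x. v (x + h) - 2 * b k"
    have vcont: "continuous_on UNIV ?\<beta>"
    proof (intro continuous_on_diff continuous_on_const)
      show "continuous_on UNIV (\<lambda>x. v (x + h))"
        by (rule continuous_on_compose2[OF subsolsD(1)[OF v]]) (auto intro!: continuous_intros)
    qed
    \<comment> \<open>If \<open>z\<close> is on \<open>frontier P\<close>, then
      \<open>w z = v z\<close> and the upper modulus suffices. If instead \<open>z + h\<close> is on
      \<open>frontier P\<close>, the lift gives \<open>w z\<close> at least \<open>v y - b k\<close>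
      while \<open>v (z + h)\<close> is at most \<open>v y + b k\<close>; this is the origin of
      \<open>2 * b k\<close>.\<close>
    have bd: "?\<beta> z \<le> w z" if z: "z \<in> frontier N" for z
    proof (cases "z \<in> P")
      case False
      have "z \<in> frontier P"
        using z False N(2) closure_mono[OF N(2)] open_P by (auto simp: frontier_def interior_open)
      then have "v (z + h) \<le> v z + b k"
        using h \<rho>[of k] by (intro up[OF v]) (auto simp: dist_norm)
      then show ?thesis using w(3)[OF False] b(2)[of k] by simp
    next
      case True
      have "z \<notin> N" using z N(1) by (simp add: frontier_def interior_open)
      then have "z + h \<notin> P" using True by (simp add: N_def)
      moreover have "z + h \<in> closure P"
      proof -
        have "z \<in> closure N" using z by (simp add: frontier_def)
        then have "(\<lambda>x. x + h) z \<in> (\<lambda>x. x + h) ` closure N" by (rule imageI)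
        also have "\<dots> \<subseteq> closure P"
          using closure_subset[of P]
          by (intro image_closure_subset) (auto simp: N_def intro!: continuous_intros)
        finally show ?thesis .
      qed
      ultimately have zh: "z + h \<in> frontier P" using open_P by (simp add: frontier_def interior_open)
      then obtain y where y: "y \<in> Y" "z + h \<in> ball y (\<rho> k / 2)" using Y(3) by blast
      have "v (z + h) \<le> v y + b k"
        using y Y(2) \<rho>[of k] by (intro up[OF v]) auto
      moreover have "z \<in> ball y (\<rho> k)"
        using y(2) h dist_triangle[of y z "z + h"] by (simp add: dist_norm)
      then have "v y - b k \<le> w z" by (rule w(4)[OF y(1)])
      ultimately show ?thesis by simp
    qed
    have "(\<lambda>x. if x \<in> N then max (w x) (?\<beta> x) else w x) \<in> subsols"
    proof (rule glue[OF w(1) N(1,3)])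
      show "continuous_on (closure N) ?\<beta>" using vcont continuous_on_subset by blast
      show "?\<beta> z < w z" if "z \<in> frontier N" "z \<notin> closure P" for z
        using that closure_mono[OF N(2)] by (auto simp: frontier_def)
      show "slope1 ?\<beta> z" if "z \<in> N" "z \<notin> closure P" for z
        using that N(2) closure_subset by blast
      show "sub_at ?\<beta> z" if "z \<in> N" for z
        using that P_sub closure_subset[of P] subsolsD(5)[OF v, of "z + h"]
        by (intro sub_at_shift) (auto simp: N_def)
    qed (rule bd)
    from perron_upper[OF this, of x] show "v (x + h) \<le> perron x + 2 * b k"
      using x by (auto simp: N_def)
  qed
  consider "x \<in> P" | "x \<in> frontier P" | "x \<notin> closure P" by (cases rule: closure_P_cases[of x])
  then show ?thesis
  proof cases
    case 3
    then show ?thesis by (intro slope1_imp_continuous perron_slope1)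
  next
    case 1
    show ?thesis unfolding continuous_at_eps_delta
    proof (intro allI impI)
      fix e :: real assume "e > 0"
      then obtain k where k: "2 * b k < e" using b_small by blast
      obtain d where d: "d > 0" "ball x d \<subseteq> P" using openE[OF open_P 1] by blast
      \<comment> \<open>Translating by \<open>y - x\<close> and by \<open>x - y\<close> turns the
        one-sided estimate into a two-sided one.\<close>
      have "\<bar>perron y - perron x\<bar> < e" if y: "dist y x < min d (\<rho> k / 2)" for y
      proof -
        have "y \<in> P" using y d by (auto simp: dist_commute)
        then show ?thesis
          using translate[of x "y - x" k] translate[of y "x - y" k] 1 y k
          by (simp add: dist_norm norm_minus_commute)
      qed
      then show "\<exists>d>0. \<forall>x'. dist x' x < d \<longrightarrow> dist (perron x') (perron x) < e"
        using d \<rho>[of k] by (intro exI[of _ "min d (\<rho> k / 2)"]) (auto simp: dist_real_def)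
    qed
  next
    case 2
    show ?thesis unfolding continuous_at_eps_delta
    proof (intro allI impI)
      fix e :: real assume "e > 0"
      then obtain k where k: "2 * b k < e" using b_small by blast
      then have k': "b k < e" using b(2)[of k] by linarith
      \<comment> \<open>The upper half holds for each competitor. For the lower half a competitor
        \<open>v\<close> is first lifted to reach \<open>v x - b k\<close> at
        \<open>y\<close>.\<close>
      have "\<bar>perron y - perron x\<bar> < e" if y: "dist y x < \<rho> k" for y
      proof -
        have yb: "y \<in> ball x (\<rho> k)" using y by (simp add: dist_commute)
        have "v y \<le> perron x + b k" if v: "v \<in> subsols" for v
          using up[OF v 2 yb] perron_upper[OF v, of x] by linarith
        then have "perron y \<le> perron x + b k" by (rule perron_least)
        moreover have "v x \<le> perron y + b k" if v: "v \<in> subsols" for v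
        proof -
          obtain w where "w \<in> subsols" "v x - b k \<le> w y" using lift[OF v 2, of k] yb by blast
          then show ?thesis using perron_upper[of w y] by linarith
        qed
        then have "perron x \<le> perron y + b k" by (rule perron_least)
        ultimately show ?thesis using k' by linarith
      qed
      then show "\<exists>d>0. \<forall>x'. dist x' x < d \<longrightarrow> dist (perron x') (perron x) < e"
        using \<rho>[of k] by (intro exI[of _ "\<rho> k"]) (auto simp: dist_real_def)
    qed
  qed
qed

section \<open>Bump arguments and the viscosity inequalities\<close>

text \<open>\<open>closure P\<close> is closed and \<open>P\<close> is open, so a small move away
  from \<open>x\<close> activates no condition that is not active at \<open>x\<close>. Strict
  inequalities at \<open>x\<close> therefore persist nearby.\<close>

lemma perturbation_nhds:
  assumes "x \<in> \<Omega>"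
  shows "\<forall>\<^sub>F y in nhds x. y \<in> \<Omega> \<and> (y \<in> closure P \<longrightarrow> x \<in> closure P) \<and> (y \<notin> P \<longrightarrow> x \<notin> P)"
proof -
  have "\<forall>\<^sub>F y in nhds x. y \<in> \<Omega>" using assms open_\<Omega> by (rule eventually_nhds_in_open[rotated])
  moreover have "\<forall>\<^sub>F y in nhds x. y \<in> closure P \<longrightarrow> x \<in> closure P"
  proof (cases "x \<in> closure P")
    case False
    then show ?thesis by (intro eventually_nhds_ball[of x "- closure P"]) auto
  qed simp
  moreover have "\<forall>\<^sub>F y in nhds x. y \<notin> P \<longrightarrow> x \<notin> P"
  proof (cases "x \<in> P")
    case True
    then show ?thesis using open_P by (intro eventually_nhds_ball[of x P]) auto
  qed simp
  ultimately show ?thesis by eventually_elim blast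
qed

text \<open>If \<open>\<phi>\<close> were strict at \<open>x\<close>, a slightly lowered
  \<open>\<phi>\<close> would bound every competitor near \<open>x\<close> by comparison, hence also
  the supremum, against contact at \<open>x\<close>.\<close>

lemma perron_not_strict:
  assumes x: "x \<in> \<Omega>" and r: "0 < r" and \<phi>: "C2_on (ball x r) \<phi>"
    and le: "\<And>y. y \<in> ball x r \<Longrightarrow> y \<in> \<Omega> \<Longrightarrow> perron y \<le> \<phi> y" and eq: "perron x = \<phi> x"
  shows "\<not> strict_at \<phi> x"
proof
  assume st: "strict_at \<phi> x"
  obtain H where H: "C2_with (ball x r) \<phi> (grad \<phi>) H" using C2_on_imp_C2_with[OF \<phi>] by auto
  have xr: "x \<in> ball x r" using r by simp
  have st': "x \<in> closure P \<longrightarrow> trace_op (H x) < - 2" "x \<notin> P \<longrightarrow> 1 < norm (grad \<phi> x)"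
    using st strict_at_C2_with[OF H open_ball xr] by auto
  define n where "n = real CARD('n)"
  have n: "0 < n" by (simp add: n_def)
  \<comment> \<open>Adding \<open>\<eta>\<close> times the squared distance raises the trace by
    \<open>2 * \<eta> * n\<close>, which is set to half of the available slack. Its gradient
    vanishes at \<open>x\<close>. Where no trace condition is active, 1 is an arbitrary positive
    choice.\<close>
  obtain \<eta> where \<eta>: "0 < \<eta>" "x \<in> closure P \<longrightarrow> trace_op (H x) + 2 * \<eta> * n < - 2"
  proof (cases "x \<in> closure P")
    case True
    define \<eta> where "\<eta> = (- 2 - trace_op (H x)) / (4 * n)"
    have "0 < \<eta>" using True st'(1) n by (simp add: \<eta>_def)
    moreover have "2 * \<eta> * n = (- 2 - trace_op (H x)) / 2" using n by (simp add: \<eta>_def)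
    ultimately show ?thesis using True st'(1) that[of \<eta>] by simp
  qed (use that[of 1] in auto)
  define G' where "G' y = grad \<phi> y + \<eta> *\<^sub>R 2 *\<^sub>R (y - x)" for y
  define H' where "H' y h = H y h + \<eta> *\<^sub>R 2 *\<^sub>R h" for y h
  have C2: "C2_with (ball x r) (\<lambda>y. \<phi> y + (m + \<eta> * ((y - x) \<bullet> (y - x)))) G' H'" for m
    unfolding G'_def[abs_def] H'_def[abs_def]
    by (intro C2_with_add H C2_with_affine C2_with_square)
  have tr: "trace_op (H' y) = trace_op (H y) + 2 * \<eta> * n" for y
    unfolding H'_def[abs_def] trace_op_add trace_op_scaleR trace_op_ident by (simp add: n_def)
  have "\<forall>\<^sub>F y in nhds x. x \<in> closure P \<longrightarrow> trace_op (H' y) < - 2"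
    using eventually_nhds_less(1)[OF C2_with_continuous(3)[OF C2] open_ball xr] \<eta>(2)
    by (cases "x \<in> closure P") (auto simp: tr)
  moreover have "\<forall>\<^sub>F y in nhds x. x \<notin> P \<longrightarrow> 1 < norm (G' y)"
    using eventually_nhds_less(2)[OF continuous_on_norm[OF C2_with_continuous(2)[OF C2]] open_ball xr] st'(2)
    by (cases "x \<in> P") (auto simp: G'_def)
  moreover have "\<forall>\<^sub>F y in nhds x. y \<in> ball x r" using xr by (intro eventually_nhds_in_open) auto
  ultimately have "\<forall>\<^sub>F y in nhds x. y \<in> ball x r \<and> y \<in> \<Omega> \<and>
      (y \<in> closure P \<longrightarrow> trace_op (H' y) < - 2) \<and> (y \<notin> P \<longrightarrow> 1 < norm (G' y))"
    using perturbation_nhds[OF x] by eventually_elim blast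
  then obtain s where s: "0 < s" and near: "\<And>y. y \<in> cball x s \<Longrightarrow> y \<in> ball x r \<and> y \<in> \<Omega> \<and>
      (y \<in> closure P \<longrightarrow> trace_op (H' y) < - 2) \<and> (y \<notin> P \<longrightarrow> 1 < norm (G' y))"
    using eventually_nhds_cball by blast
  \<comment> \<open>Equal to \<open>\<phi>\<close> on the sphere of radius \<open>s\<close> and
    lower by \<open>\<eta> * s^2\<close> at the centre.\<close>
  let ?\<Psi> = "\<lambda>y. \<phi> y + (- (\<eta> * s^2) + \<eta> * ((y - x) \<bullet> (y - x)))"
  have sub: "ball x s \<subseteq> ball x r" "cball x s \<subseteq> ball x r" "ball x s \<subseteq> \<Omega>" using near by auto
  have cl: "closure (ball x s) = cball x s" "frontier (ball x s) = sphere x s" using s by auto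
  have "perron x \<le> ?\<Psi> x"
  proof (rule perron_least)
    fix v assume v: "v \<in> subsols"
    show "v x \<le> ?\<Psi> x"
    proof (rule comparison[OF v open_ball sub(3) C2_with_subset[OF C2 sub(1)]])
      show "continuous_on (closure (ball x s)) ?\<Psi>"
        unfolding cl using C2_with_continuous(1)[OF C2] sub(2) continuous_on_subset by blast
      show "strict_at ?\<Psi> y" if "y \<in> ball x s" for y
        using near[of y] that sub(1) by (subst strict_at_C2_with[OF C2 open_ball]) auto
      show "v y \<le> ?\<Psi> y" if y: "y \<in> frontier (ball x s)" for y
      proof -
        have d: "dist x y = s" using y unfolding cl by simp
        then have "(y - x) \<bullet> (y - x) = s^2" by (simp add: dist_norm norm_minus_commute flip: power2_norm_eq_inner)
        moreover have "v y \<le> \<phi> y"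
          using perron_upper[OF v, of y] le[of y] near[of y] d by fastforce
        ultimately show ?thesis by simp
      qed
    qed (use s in simp)
  qed
  moreover have "0 < \<eta> * s^2" using \<eta>(1) s by simp
  ultimately show False using eq by simp
qed

text \<open>Continuity enters here: it makes the supremum itself a competitor, so that it can be
  glued with a bump and contradict its own maximality.\<close>

lemma perron_subsol: "perron \<in> subsols"
proof -
  have "sub_at perron x" if x: "x \<in> \<Omega>" for x
    unfolding sub_at_def
  proof (intro allI impI)
    fix r :: real and \<phi> assume "0 < r" "C2_on (ball x r) \<phi>" "\<forall>y\<in>ball x r. perron y \<le> \<phi> y" "perron x = \<phi> x"
    then have "\<not> strict_at \<phi> x" by (intro perron_not_strict[OF x]) auto
    then show "(x \<in> P \<longrightarrow> H_plus \<phi> x \<le> 0) \<and> (x \<in> frontier P \<longrightarrow> min (H_minus \<phi> x) (H_plus \<phi> x) \<le> 0)"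
      by (cases rule: closure_P_cases[of x]) (auto simp: strict_at_def)
  qed
  then show ?thesis
    unfolding subsols_def
    using perron_continuous perron_nonneg perron_outside perron_slope1
    by (auto simp: continuous_at_imp_continuous_on)
qed

text \<open>One disjunction covers the three regions: the first alternative is impossible off
  \<open>closure P\<close>, the second inside \<open>P\<close>, and on the interface either may
  hold. If both failed, a bump on \<open>\<phi>\<close> would be a subsolution rising above the
  supremum at \<open>x\<close>.\<close>

lemma perron_supersol:
  assumes x: "x \<in> \<Omega>" and r: "0 < r" and \<phi>: "C2_on (ball x r) \<phi>"
    and le: "\<And>y. y \<in> ball x r \<Longrightarrow> y \<in> \<Omega> \<Longrightarrow> \<phi> y \<le> perron y" and eq: "perron x = \<phi> x"
  shows "(x \<in> closure P \<and> 0 \<le> H_plus \<phi> x) \<or> (x \<notin> P \<and> 0 \<le> H_minus \<phi> x)"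
proof (rule ccontr)
  assume neg: "\<not> ?thesis"
  obtain H where H: "C2_with (ball x r) \<phi> (grad \<phi>) H" using C2_on_imp_C2_with[OF \<phi>] by auto
  have xr: "x \<in> ball x r" using r by simp
  have st': "x \<in> closure P \<longrightarrow> - 2 < trace_op (H x)" "x \<notin> P \<longrightarrow> norm (grad \<phi> x) < 1"
    using neg C2_with_H[OF H open_ball xr] by auto
  define n where "n = real CARD('n)"
  have n: "0 < n" by (simp add: n_def)
  obtain \<eta> where \<eta>: "0 < \<eta>" "x \<in> closure P \<longrightarrow> - 2 < trace_op (H x) - 2 * \<eta> * n"
  proof (cases "x \<in> closure P")
    case True
    define \<eta> where "\<eta> = (2 + trace_op (H x)) / (4 * n)"
    have "0 < \<eta>" using True st'(1) n by (simp add: \<eta>_def)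
    moreover have "2 * \<eta> * n = (2 + trace_op (H x)) / 2" using n by (simp add: \<eta>_def)
    ultimately show ?thesis using True st'(1) that[of \<eta>] by simp
  qed (use that[of 1] in auto)
  define G' where "G' y = grad \<phi> y + (- \<eta>) *\<^sub>R 2 *\<^sub>R (y - x)" for y
  define H' where "H' y h = H y h + (- \<eta>) *\<^sub>R 2 *\<^sub>R h" for y h
  have C2: "C2_with (ball x r) (\<lambda>y. \<phi> y + (m + (- \<eta>) * ((y - x) \<bullet> (y - x)))) G' H'" for m
    unfolding G'_def[abs_def] H'_def[abs_def]
    by (intro C2_with_add H C2_with_affine C2_with_square)
  have tr: "trace_op (H' y) = trace_op (H y) - 2 * \<eta> * n" for y
    unfolding H'_def[abs_def] trace_op_add trace_op_scaleR trace_op_ident by (simp add: n_def)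
  have "\<forall>\<^sub>F y in nhds x. x \<in> closure P \<longrightarrow> - 2 < trace_op (H' y)"
    using eventually_nhds_less(2)[OF C2_with_continuous(3)[OF C2] open_ball xr] \<eta>(2)
    by (cases "x \<in> closure P") (auto simp: tr)
  moreover have "\<forall>\<^sub>F y in nhds x. x \<notin> P \<longrightarrow> norm (G' y) < 1"
    using eventually_nhds_less(1)[OF continuous_on_norm[OF C2_with_continuous(2)[OF C2]] open_ball xr] st'(2)
    by (cases "x \<in> P") (auto simp: G'_def)
  moreover have "\<forall>\<^sub>F y in nhds x. y \<in> ball x r" using xr by (intro eventually_nhds_in_open) auto
  ultimately have "\<forall>\<^sub>F y in nhds x. y \<in> ball x r \<and> y \<in> \<Omega> \<and>
      (y \<in> closure P \<longrightarrow> - 2 < trace_op (H' y)) \<and> (y \<notin> P \<longrightarrow> norm (G' y) < 1)"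
    using perturbation_nhds[OF x] by eventually_elim blast
  then obtain s where s: "0 < s" and near: "\<And>y. y \<in> cball x s \<Longrightarrow> y \<in> ball x r \<and> y \<in> \<Omega> \<and>
      (y \<in> closure P \<longrightarrow> - 2 < trace_op (H' y)) \<and> (y \<notin> P \<longrightarrow> norm (G' y) < 1)"
    using eventually_nhds_cball by blast
  \<comment> \<open>The offset is half of \<open>\<eta> * s^2\<close>, so the bump exceeds
    \<open>\<phi>\<close> at the centre and is strictly below it on the sphere, as gluing off
    \<open>closure P\<close> demands.\<close>
  let ?\<beta> = "\<lambda>y. \<phi> y + (\<eta> * s^2 / 2 + (- \<eta>) * ((y - x) \<bullet> (y - x)))"
  have sub: "cball x s \<subseteq> ball x r" "ball x s \<subseteq> \<Omega>" using near by auto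
  have cl: "closure (ball x s) = cball x s" "frontier (ball x s) = sphere x s" using s by auto
  have bd: "?\<beta> y < perron y" if y: "y \<in> frontier (ball x s)" for y
  proof -
    have d: "dist x y = s" using y unfolding cl by simp
    then have "(y - x) \<bullet> (y - x) = s^2" by (simp add: dist_norm norm_minus_commute flip: power2_norm_eq_inner)
    moreover have "\<phi> y \<le> perron y" using le[of y] near[of y] d by fastforce
    moreover have "0 < \<eta> * s^2" using \<eta>(1) s by simp
    ultimately show ?thesis by simp
  qed
  have "(\<lambda>y. if y \<in> ball x s then max (perron y) (?\<beta> y) else perron y) \<in> subsols"
  proof (rule glue[OF perron_subsol open_ball sub(2)])
    show "continuous_on (closure (ball x s)) ?\<beta>"
      unfolding cl using C2_with_continuous(1)[OF C2] sub(1) continuous_on_subset by blast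
    show "slope1 ?\<beta> y" if "y \<in> ball x s" "y \<notin> closure P" for y
      using near[of y] that closure_subset[of P] by (intro slope1_C2[OF C2]) auto
    show "sub_at ?\<beta> y" if "y \<in> ball x s" "y \<in> closure P" for y
      using near[of y] that by (intro sub_at_C2[OF C2 open_ball]) auto
  qed (use bd in \<open>auto intro: less_imp_le\<close>)
  from perron_upper[OF this, of x] have "?\<beta> x \<le> perron x" using s by simp
  moreover have "0 < \<eta> * s^2" using \<eta>(1) s by simp
  ultimately show False using eq by simp
qed

lemma perron_viscosity_solution:
  "viscosity_solution \<Omega> (\<Omega> - closure P) P (\<Omega> \<inter> frontier P) perron"
  unfolding viscosity_solution_def
proof (intro conjI ballI allI impI)
  show "continuous_on (closure \<Omega>) perron"
    using perron_continuous by (simp add: continuous_at_imp_continuous_on)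
next
  fix x r \<phi> assume x: "x \<in> \<Omega>" and r: "0 < r"
    and t: "C2_on (ball x r) \<phi> \<and> touches_above (closure \<Omega>) perron (ball x r) \<phi> x"
  then have ns: "\<not> strict_at \<phi> x"
    using closure_subset[of \<Omega>] by (intro perron_not_strict[OF x r]) (auto simp: touches_above_def)
  show "H_minus \<phi> x \<le> 0" if "x \<in> \<Omega> - closure P"
    using ns that by (cases rule: closure_P_cases[of x]) (auto simp: strict_at_def)
  show "H_plus \<phi> x \<le> 0" if "x \<in> P"
    using ns that by (cases rule: closure_P_cases[of x]) (auto simp: strict_at_def)
  show "min (H_minus \<phi> x) (H_plus \<phi> x) \<le> 0" if "x \<in> \<Omega> \<inter> frontier P"
    using ns that by (cases rule: closure_P_cases[of x]) (auto simp: strict_at_def)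
next
  fix x r \<phi> assume x: "x \<in> \<Omega>" and r: "0 < r"
    and t: "C2_on (ball x r) \<phi> \<and> touches_below (closure \<Omega>) perron (ball x r) \<phi> x"
  then have sup: "(x \<in> closure P \<and> 0 \<le> H_plus \<phi> x) \<or> (x \<notin> P \<and> 0 \<le> H_minus \<phi> x)"
    using closure_subset[of \<Omega>] by (intro perron_supersol[OF x r]) (auto simp: touches_below_def)
  show "H_minus \<phi> x \<ge> 0" if "x \<in> \<Omega> - closure P" using sup that by auto
  show "H_plus \<phi> x \<ge> 0" if "x \<in> P" using sup that by auto
  show "max (H_minus \<phi> x) (H_plus \<phi> x) \<ge> 0" if "x \<in> \<Omega> \<inter> frontier P" using sup by auto
qed

end

theorem corollary2p10:
  fixes \<Omega> \<Omega>p \<Omega>m \<Gamma> :: "(real ^ 'n::finite) set" and k :: 'n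
  assumes "open \<Omega>" "bounded \<Omega>" "open \<Omega>p" "bounded \<Omega>p" "\<Omega>p \<subseteq> \<Omega>"
    and "\<Omega>m = \<Omega> - closure \<Omega>p"
    and "\<Gamma> = \<Omega> - (\<Omega>p \<union> \<Omega>m)"
    and "\<Gamma> = frontier \<Omega>p \<inter> \<Omega>" "\<Gamma> = frontier \<Omega>m \<inter> \<Omega>"
    and "uniformly_lipschitz_regular k \<Omega>p" "uniformly_lipschitz_regular k \<Omega>m"
  shows "\<exists>u. continuous_on (closure \<Omega>) u \<and> viscosity_solution \<Omega> \<Omega>m \<Omega>p \<Gamma> u \<and>
             (\<forall>x\<in>frontier \<Omega>. u x = 0)"
proof -
  obtain c r0 C where geometry: "0 < c" "c \<le> 1/8" "0 < r0" "r0 \<le> 1" "0 \<le> C"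
    "\<And>y r. y \<in> frontier \<Omega>p \<Longrightarrow> 0 < r \<Longrightarrow> r \<le> r0 \<Longrightarrow>
       \<exists>z. dist z y \<le> r/4 \<and> ball z (c * r) \<inter> closure \<Omega>p = {}"
    "\<And>v x y. continuous_on UNIV v \<Longrightarrow> (\<And>x. x \<notin> closure \<Omega>p \<Longrightarrow> slope1 v x) \<Longrightarrow>
       y \<in> frontier \<Omega>p \<Longrightarrow> x \<notin> \<Omega>p \<Longrightarrow> dist x y < r0 \<Longrightarrow> \<bar>v x - v y\<bar> \<le> C * dist x y"
    using regular_exterior[OF assms(10)] by blast
  interpret mixed_problem \<Omega> \<Omega>p c r0 C
    by unfold_locales (rule assms geometry; assumption)+
  have "viscosity_solution \<Omega> \<Omega>m \<Omega>p \<Gamma> perron"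
    using perron_viscosity_solution assms(6,8) by (simp add: Int_commute)
  moreover have "perron x = 0" if "x \<in> frontier \<Omega>" for x
    using that assms(1) by (intro perron_outside) (simp add: frontier_def interior_open)
  ultimately show ?thesis
    by (intro exI[of _ perron]) (auto simp: viscosity_solution_def)
qed

end
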